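(* Let $X$ be a smooth manifold, let $\nabla$ be the extension to tensor sections of any torsion free connection on the tangent bundle $T_X$, and let $A$ be a smooth endomorphism section of $T_X$. Let $k\geqslant 1$ and $h\geqslant 0$ be integers. Then for any family of smooth vector fields $(\xi_j)_{j=1}^k$ on $X$ one has $$\frac{1}{h!}\left\|\nabla^h\left(\prod_{j=1}^k L_{\xi_j}\right)A\right\|_r\ \leqslant\ C_r^k\sum_{\substack{P\in \mathrm{Dyck}(k)\\ H\in\mathbb{N}^{k+1}(h)}} C_P\,\frac{1}{h_{k+1}!}\,\bigl\|\nabla^{h_{k+1}+D_{P,k}}A\bigr\|_r\ \prod_{j=1}^k\frac{1}{h_j!}\,\bigl\|\nabla^{h_j+p_j}\xi_j\bigr\|_r ,$$ where $P=(p_1,\dots,p_k)$, $H=(h_1,\dots,h_{k+1})$, $$\mathrm{Dyck}(k)=\Bigl\{P=(p_1,\dots,p_k)\in\mathbb{N}^k\ \Big|\ \sum_{1\leqslant r\leqslant j}p_r\leqslant j\ \ \forall j\in\{1,\dots,k\}\Bigr\},\qquad D_{P,j}=j-\sum_{1\leqslant r\leqslant j}p_r ,$$ and $$C_P=\prod_{j=1}^k\left[2\binom{D_{P,j-1}}{p_j-1}+\binom{D_{P,j-1}}{p_j}\right]=\prod_{\substack{1\leqslant j\leqslant k\\ p_j\neq 0}}\left(2+\frac{D_{P,j}}{p_j}\right)\binom{D_{P,j-1}}{p_j-1},$$ with the convention $\binom{m}{n}=0$ if $n\notin\{0,1,\dots,m\}$.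
   Context: $\mathbb{N}=\{0,1,2,\dots\}$, and $\mathbb{N}^{l}(h)$ is the set of $(h_1,\dots,h_l)\in\mathbb{N}^l$ with $\sum_j h_j=h$. $D_{P,0}=0$. $L_\xi$ is the Lie derivative along $\xi$; $\prod_{j=1}^kL_{\xi_j}=L_{\xi_1}\circ L_{\xi_2}\circ\cdots\circ L_{\xi_k}$ (products over ordered index sets are taken from left to right). $\nabla^h$ is the $h$-th iterated covariant derivative: writing $\nabla^h_{\xi_1\otimes\cdots\otimes\xi_h}=(\xi_1\otimes\cdots\otimes\xi_h)\neg\nabla^h$ for evaluation on vector fields, it is defined inductively by $\nabla^{h+1}_{\xi_0\otimes\cdots\otimes\xi_h}=\nabla_{\xi_0}\nabla^h_{\xi_1\otimes\cdots\otimes\xi_h}-\sum_{p=1}^h\nabla^h_{\xi_1\otimes\cdots\otimes\nabla_{\xi_0}\xi_p\otimes\cdots\otimes\xi_h}$, with $\nabla^0=\mathrm{id}$. Norm: $X$ is equipped with a smooth Riemannian metric $g$, and $\|\cdot\|_r$ is the Sobolev norm on $H^r(X,(T_X^* )^{\otimes q}\otimes T_X^{\otimes p})$ built from the covariant derivatives of order up to $r$, measured pointwise with the max norm on multilinear forms with respect to $g$ (supremum of the norm of the value over $g$-unit vector arguments). The integer $r$ is fixed sufficiently large that these Sobolev spaces form an algebra: there is a constant $C_r>0$ with $\|uv\|_r\leqslant C_r\|u\|_r\|v\|_r$ for all tensors $u,v$ and all products $uv$ of tensors obtained by inserting a $T_X$-valued multilinear tensor $v$ into an argument slot of $u$ (composition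 of endomorphisms, evaluation/contraction of a multilinear map on vector fields or on vector-valued tensors, the remaining arguments being listed in any order). $C_r$ in the estimate is this constant. The estimate is asserted for any such algebra norm. *)

theory Defs
  imports
    "HOL-Analysis.Analysis"
    "HOL-Combinatorics.Permutations"
    "HOL-Library.Function_Algebras"
begin

section \<open>Smooth manifolds and smooth functions\<close>

primrec ck_on :: "nat \<Rightarrow> 'e::euclidean_space set \<Rightarrow> ('e \<Rightarrow> 'f::euclidean_space) \<Rightarrow> bool" where
  "ck_on 0 S f \<longleftrightarrow> continuous_on S f"
| "ck_on (Suc m) S f \<longleftrightarrow>
     (\<forall>x\<in>S. f differentiable (at x)) \<and>
     (\<forall>v. ck_on m S (\<lambda>x. frechet_derivative f (at x) v))"

text \<open>To be used on open sets only.\<close>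
definition smooth_on :: "'e::euclidean_space set \<Rightarrow> ('e \<Rightarrow> 'f::euclidean_space) \<Rightarrow> bool" where
  "smooth_on S f \<longleftrightarrow> (\<forall>m. ck_on m S f)"

type_synonym ('a, 'n) atlas = "('a set \<times> ('a \<Rightarrow> real ^ 'n)) set"

text \<open>The manifold is the whole type \<open>'a\<close>; its Hausdorff and second countability
  axioms are the type classes. An atlas consists of pairs of a chart domain and a chart, whose
  values off the domain are irrelevant. It need not be maximal.\<close>
definition smooth_manifold ::
    "('a::{t2_space, second_countable_topology}, 'n::finite) atlas \<Rightarrow> bool" where
  "smooth_manifold M \<longleftrightarrow>
     (\<Union>(U, \<phi>)\<in>M. U) = UNIV \<and>
     (\<forall>(U, \<phi>)\<in>M. open U \<and> open (\<phi> ` U) \<and> homeomorphism U (\<phi> ` U) \<phi> (inv_into U \<phi>)) \<and>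
     (\<forall>(U, \<phi>)\<in>M. \<forall>(V, \<psi>)\<in>M. smooth_on (\<phi> ` (U \<inter> V)) (\<psi> \<circ> inv_into U \<phi>))"

definition smooth_functions :: "('a, 'n::finite) atlas \<Rightarrow> ('a \<Rightarrow> real) set" where
  "smooth_functions M = {f. \<forall>(U, \<phi>)\<in>M. smooth_on (\<phi> ` U) (f \<circ> inv_into U \<phi>)}"


section \<open>Tangent vectors and vector fields\<close>

text \<open>Tangent vectors are the derivations of the algebra of smooth functions at a point. They are
  extended by zero to non-smooth functions, so that equality of tangent vectors is equality.\<close>
definition tangent_space :: "('a, 'n::finite) atlas \<Rightarrow> 'a \<Rightarrow> (('a \<Rightarrow> real) \<Rightarrow> real) set" where
  "tangent_space M p = {v.
     (\<forall>f. f \<notin> smooth_functions M \<longrightarrow> v f = 0) \<and>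
     (\<forall>f\<in>smooth_functions M. \<forall>c. v (\<lambda>x. c * f x) = c * v f) \<and>
     (\<forall>f\<in>smooth_functions M. \<forall>h\<in>smooth_functions M.
        v (\<lambda>x. f x + h x) = v f + v h \<and>
        v (\<lambda>x. f x * h x) = v f * h p + f p * v h)}"

type_synonym 'a vfield = "'a \<Rightarrow> ('a \<Rightarrow> real) \<Rightarrow> real"

definition vector_fields :: "('a, 'n::finite) atlas \<Rightarrow> 'a vfield set" where
  "vector_fields M = {\<xi>.
     (\<forall>p. \<xi> p \<in> tangent_space M p) \<and>
     (\<forall>f\<in>smooth_functions M. (\<lambda>p. \<xi> p f) \<in> smooth_functions M)}"

definition fmult :: "('a \<Rightarrow> real) \<Rightarrow> 'a vfield \<Rightarrow> 'a vfield" where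
  "fmult f \<xi> = (\<lambda>p \<phi>. f p * \<xi> p \<phi>)"

definition lie_bracket :: "'a vfield \<Rightarrow> 'a vfield \<Rightarrow> 'a vfield" where
  "lie_bracket \<xi> \<eta> = (\<lambda>p f. \<xi> p (\<lambda>q. \<eta> q f) - \<eta> p (\<lambda>q. \<xi> q f))"


section \<open>Tensor fields\<close>

type_synonym 'a tensor = "'a vfield list \<Rightarrow> 'a vfield"

text \<open>Smooth sections of \<open>(T\<^sub>X\<^sup>*)\<^sup>\<otimes>\<^sup>q \<otimes> T\<^sub>X\<close>, as maps on \<open>q\<close>-tuples of vector fields that are
  multilinear over the ring of smooth functions. They are extended by zero to all lists that are
  not \<open>q\<close>-tuples of vector fields.\<close>
definition tensor_fields :: "('a, 'n::finite) atlas \<Rightarrow> nat \<Rightarrow> 'a tensor set" where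
  "tensor_fields M q = {u.
     (\<forall>zs. \<not> (length zs = q \<and> set zs \<subseteq> vector_fields M) \<longrightarrow> u zs = 0) \<and>
     (\<forall>zs. length zs = q \<and> set zs \<subseteq> vector_fields M \<longrightarrow>
        u zs \<in> vector_fields M \<and>
        (\<forall>i<q. \<forall>\<xi>\<in>vector_fields M. \<forall>\<eta>\<in>vector_fields M.
           u (zs[i := \<xi> + \<eta>]) = u (zs[i := \<xi>]) + u (zs[i := \<eta>])) \<and>
        (\<forall>i<q. \<forall>\<xi>\<in>vector_fields M. \<forall>f\<in>smooth_functions M.
           u (zs[i := fmult f \<xi>]) = fmult f (u (zs[i := \<xi>]))))}"

definition vector_tensor :: "'a vfield \<Rightarrow> 'a tensor" where
  "vector_tensor \<xi> = (\<lambda>zs. if zs = [] then \<xi> else 0)"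

definition lie_derivative ::
    "('a, 'n::finite) atlas \<Rightarrow> 'a vfield \<Rightarrow> 'a tensor \<Rightarrow> 'a tensor" where
  "lie_derivative M \<xi> u = (\<lambda>zs.
     if set zs \<subseteq> vector_fields M
     then lie_bracket \<xi> (u zs) - (\<Sum>i<length zs. u (zs[i := lie_bracket \<xi> (zs ! i)]))
     else 0)"

text \<open>The tensor of rank \<open>m - 1 + n\<close> obtained by inserting \<open>v\<close> (of rank \<open>n\<close>) into slot \<open>i\<close>
  of \<open>u\<close> (of rank \<open>m\<close>), with the arguments listed in the order given by \<open>\<pi>\<close>.\<close>
definition insert_tensor :: "('a, 'n::finite) atlas \<Rightarrow> nat \<Rightarrow> nat \<Rightarrow> nat \<Rightarrow> (nat \<Rightarrow> nat) \<Rightarrow>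
    'a tensor \<Rightarrow> 'a tensor \<Rightarrow> 'a tensor" where
  "insert_tensor M m n i \<pi> u v = (\<lambda>zs.
     if length zs = m - 1 + n \<and> set zs \<subseteq> vector_fields M
     then let ws = permute_list \<pi> zs
          in u (take i ws @ [v (take n (drop i ws))] @ drop (i + n) ws)
     else 0)"


section \<open>Connections\<close>

definition connection :: "('a, 'n::finite) atlas \<Rightarrow> ('a vfield \<Rightarrow> 'a vfield \<Rightarrow> 'a vfield) \<Rightarrow> bool" where
  "connection M nab \<longleftrightarrow>
     (\<forall>\<xi>\<in>vector_fields M. \<forall>\<eta>\<in>vector_fields M. nab \<xi> \<eta> \<in> vector_fields M) \<and>
     (\<forall>\<xi>\<in>vector_fields M. \<forall>\<xi>'\<in>vector_fields M. \<forall>\<eta>\<in>vector_fields M.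
        nab (\<xi> + \<xi>') \<eta> = nab \<xi> \<eta> + nab \<xi>' \<eta> \<and>
        nab \<eta> (\<xi> + \<xi>') = nab \<eta> \<xi> + nab \<eta> \<xi>') \<and>
     (\<forall>f\<in>smooth_functions M. \<forall>\<xi>\<in>vector_fields M. \<forall>\<eta>\<in>vector_fields M.
        nab (fmult f \<xi>) \<eta> = fmult f (nab \<xi> \<eta>) \<and>
        nab \<xi> (fmult f \<eta>) = fmult (\<lambda>p. \<xi> p f) \<eta> + fmult f (nab \<xi> \<eta>))"

definition torsion_free ::
    "('a, 'n::finite) atlas \<Rightarrow> ('a vfield \<Rightarrow> 'a vfield \<Rightarrow> 'a vfield) \<Rightarrow> bool" where
  "torsion_free M nab \<longleftrightarrow>
     (\<forall>\<xi>\<in>vector_fields M. \<forall>\<eta>\<in>vector_fields M. nab \<xi> \<eta> - nab \<eta> \<xi> = lie_bracket \<xi> \<eta>)"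

definition tensor_nabla :: "('a, 'n::finite) atlas \<Rightarrow> ('a vfield \<Rightarrow> 'a vfield \<Rightarrow> 'a vfield) \<Rightarrow>
    'a vfield \<Rightarrow> 'a tensor \<Rightarrow> 'a tensor" where
  "tensor_nabla M nab \<xi> u = (\<lambda>zs.
     if set zs \<subseteq> vector_fields M
     then nab \<xi> (u zs) - (\<Sum>i<length zs. u (zs[i := nab \<xi> (zs ! i)]))
     else 0)"

fun nabla_along :: "('a, 'n::finite) atlas \<Rightarrow> ('a vfield \<Rightarrow> 'a vfield \<Rightarrow> 'a vfield) \<Rightarrow>
    'a vfield list \<Rightarrow> 'a tensor \<Rightarrow> 'a tensor" where
  "nabla_along M nab [] u = u"
| "nabla_along M nab (\<xi> # \<xi>s) u =
     tensor_nabla M nab \<xi> (nabla_along M nab \<xi>s u)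
     - (\<Sum>p<length \<xi>s. nabla_along M nab (\<xi>s[p := nab \<xi> (\<xi>s ! p)]) u)"

text \<open>The tensor \<open>\<nabla>\<^sup>h u\<close>; the \<open>h\<close> directions of differentiation are its first arguments.\<close>
definition nabla_pow :: "('a, 'n::finite) atlas \<Rightarrow> ('a vfield \<Rightarrow> 'a vfield \<Rightarrow> 'a vfield) \<Rightarrow>
    nat \<Rightarrow> 'a tensor \<Rightarrow> 'a tensor" where
  "nabla_pow M nab h u = (\<lambda>zs.
     if h \<le> length zs \<and> set zs \<subseteq> vector_fields M
     then nabla_along M nab (take h zs) u (drop h zs)
     else 0)"


section \<open>Riemannian metrics and Sobolev norms\<close>

type_synonym 'a metric = "'a \<Rightarrow> (('a \<Rightarrow> real) \<Rightarrow> real) \<Rightarrow> (('a \<Rightarrow> real) \<Rightarrow> real) \<Rightarrow> real"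

definition riemannian_metric :: "('a, 'n::finite) atlas \<Rightarrow> 'a metric \<Rightarrow> bool" where
  "riemannian_metric M g \<longleftrightarrow>
     (\<forall>p. \<forall>v\<in>tangent_space M p. \<forall>w\<in>tangent_space M p.
        g p v w = g p w v \<and>
        (\<forall>c. g p (\<lambda>f. c * v f) w = c * g p v w) \<and>
        (\<forall>v'\<in>tangent_space M p. g p (v + v') w = g p v w + g p v' w) \<and>
        (v \<noteq> 0 \<longrightarrow> g p v v > 0)) \<and>
     (\<forall>\<xi>\<in>vector_fields M. \<forall>\<eta>\<in>vector_fields M.
        (\<lambda>p. g p (\<xi> p) (\<eta> p)) \<in> smooth_functions M)"

definition coord_vector ::
    "('a, 'n::finite) atlas \<Rightarrow> 'a set \<Rightarrow> ('a \<Rightarrow> real ^ 'n) \<Rightarrow> 'a \<Rightarrow> 'n \<Rightarrow> ('a \<Rightarrow> real) \<Rightarrow> real" where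
  "coord_vector M U \<phi> p i = (\<lambda>f.
     if f \<in> smooth_functions M
     then frechet_derivative (f \<circ> inv_into U \<phi>) (at (\<phi> p)) (axis i 1)
     else 0)"

definition gram_matrix ::
    "('a, 'n::finite) atlas \<Rightarrow> 'a metric \<Rightarrow> 'a set \<Rightarrow> ('a \<Rightarrow> real ^ 'n) \<Rightarrow> 'a \<Rightarrow> real ^ 'n ^ 'n" where
  "gram_matrix M g U \<phi> p = (\<chi> i j. g p (coord_vector M U \<phi> p i) (coord_vector M U \<phi> p j))"

definition riemannian_volume ::
    "('a::topological_space, 'n::finite) atlas \<Rightarrow> 'a metric \<Rightarrow> 'a measure \<Rightarrow> bool" where
  "riemannian_volume M g vol \<longleftrightarrow>
     sets vol = sets borel \<and>
     (\<forall>(U, \<phi>)\<in>M. \<forall>B\<in>sets borel. B \<subseteq> U \<longrightarrow>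
        emeasure vol B =
          (\<integral>\<^sup>+y. ennreal (sqrt (det (gram_matrix M g U \<phi> (inv_into U \<phi> y)))) * indicator (\<phi> ` B) y
             \<partial>lborel))"

text \<open>By tensoriality the supremum over unit vectors at \<open>p\<close> may be taken over vector fields of
  unit length at \<open>p\<close>.\<close>
definition max_norm :: "('a, 'n::finite) atlas \<Rightarrow> 'a metric \<Rightarrow> nat \<Rightarrow> 'a tensor \<Rightarrow> 'a \<Rightarrow> ennreal" where
  "max_norm M g q u p =
     (SUP zs\<in>{zs. length zs = q \<and> set zs \<subseteq> {\<xi>\<in>vector_fields M. g p (\<xi> p) (\<xi> p) = 1}}.
        ennreal (sqrt (g p (u zs p) (u zs p))))"

definition ennreal_sqrt :: "ennreal \<Rightarrow> ennreal" where
  "ennreal_sqrt x = (if x = top then top else ennreal (sqrt (enn2real x)))"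

text \<open>The norm of a tensor of rank \<open>q\<close>. It is infinite on smooth tensors that are not in the
  Sobolev space, which can happen only on a non-compact manifold.\<close>
definition sobolev_norm :: "('a, 'n::finite) atlas \<Rightarrow> ('a vfield \<Rightarrow> 'a vfield \<Rightarrow> 'a vfield) \<Rightarrow>
    'a metric \<Rightarrow> 'a measure \<Rightarrow> nat \<Rightarrow> nat \<Rightarrow> 'a tensor \<Rightarrow> ennreal" where
  "sobolev_norm M nab g vol r q u =
     ennreal_sqrt (\<Sum>s\<le>r. \<integral>\<^sup>+p. (max_norm M g (s + q) (nabla_pow M nab s u) p)\<^sup>2 \<partial>vol)"

text \<open>A norm (possibly taking the value infinity) on the tensor fields of each rank.\<close>
definition tensor_norm :: "('a, 'n::finite) atlas \<Rightarrow> (nat \<Rightarrow> 'a tensor \<Rightarrow> ennreal) \<Rightarrow> bool" where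
  "tensor_norm M N \<longleftrightarrow>
     (\<forall>q. \<forall>u\<in>tensor_fields M q.
        (N q u = 0 \<longleftrightarrow> u = 0) \<and>
        (\<forall>c::real. N q (\<lambda>zs. fmult (\<lambda>_. c) (u zs)) = ennreal \<bar>c\<bar> * N q u) \<and>
        (\<forall>v\<in>tensor_fields M q. N q (u + v) \<le> N q u + N q v))"

definition algebra_constant ::
    "('a, 'n::finite) atlas \<Rightarrow> (nat \<Rightarrow> 'a tensor \<Rightarrow> ennreal) \<Rightarrow> real \<Rightarrow> bool" where
  "algebra_constant M N C \<longleftrightarrow> C > 0 \<and>
     (\<forall>m n. \<forall>u\<in>tensor_fields M m. \<forall>v\<in>tensor_fields M n. \<forall>i<m. \<forall>\<pi>. \<pi> permutes {..<m - 1 + n} \<longrightarrow>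
        N (m - 1 + n) (insert_tensor M m n i \<pi> u v) \<le> ennreal C * N m u * N n v)"


section \<open>Dyck paths\<close>

text \<open>Families indexed by \<open>{1..k}\<close> are extensional functions, as in \<open>PiE\<close>.\<close>
definition Dyck :: "nat \<Rightarrow> (nat \<Rightarrow> nat) set" where
  "Dyck k = {P \<in> {1..k} \<rightarrow>\<^sub>E UNIV. \<forall>j\<in>{1..k}. (\<Sum>r = 1..j. P r) \<le> j}"

definition compositions :: "nat \<Rightarrow> nat \<Rightarrow> (nat \<Rightarrow> nat) set" where
  "compositions l h = {H \<in> {1..l} \<rightarrow>\<^sub>E UNIV. (\<Sum>j = 1..l. H j) = h}"

definition Dyck_D :: "(nat \<Rightarrow> nat) \<Rightarrow> nat \<Rightarrow> int" where
  "Dyck_D P j = int j - (\<Sum>r = 1..j. int (P r))"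

definition binom :: "int \<Rightarrow> int \<Rightarrow> nat" where
  "binom m n = (if 0 \<le> n \<and> n \<le> m then nat m choose nat n else 0)"

definition Dyck_C :: "nat \<Rightarrow> (nat \<Rightarrow> nat) \<Rightarrow> nat" where
  "Dyck_C k P = (\<Prod>j = 1..k. 2 * binom (Dyck_D P (j - 1)) (int (P j) - 1)
                              + binom (Dyck_D P (j - 1)) (int (P j)))"

end

(*
  Since the connection is torsion free, L_xi B = xi.(nabla B) - (nabla xi) B + B (nabla xi), a sum of
  three tensor insertions. The covariant derivative of an insertion of v into u is the sum of an
  insertion of v into nabla u and one of nabla v into u, so the norm of nabla^s of an insertion
  satisfies a binomial Leibniz estimate. Applied to nabla^(h+d) (L_xi B), and split by Vandermonde
  into h and d derivatives, it produces one step of a Dyck path: p of the d derivatives (one of them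
  possibly coming from nabla xi, whence the coefficient 2 binom(d, p-1) + binom(d, p)) fall on xi and
  d + 1 - p remain on B. The estimate follows by peeling off xi_1, xi_2, ... in turn.
  The Sobolev norm is subadditive by Minkowski's inequality, which needs the pointwise max norm to
  be measurable; it is lower semicontinuous.
*)

theory Submission
  imports Defs
begin

section \<open>Smooth functions and vector fields\<close>

text \<open>Iterating the Leibniz rule needs a class of expressions that differentiation does not
  leave. The new direction of a derivative is always the first argument, whereas differentiating the
  inserted \<open>v\<close> wants it at slot \<open>i\<close> of \<open>u\<close>; hence insertions
  carry an arbitrary order of their arguments, and \<open>algebra_constant\<close> quantifies over
  permutations. As every derivative of an insertion is again a sum of insertions, the algebra
  inequality is applied only after all derivatives have been distributed, and each Lie derivative
  costs one factor \<open>C\<close> however often it is differentiated.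

  The derivatives on the part of the product not yet expanded are of two kinds. Those left from
  \<nabla>^h are spread with multinomial coefficients, which the factorials absorb. The
  \<open>Dyck_D P j\<close> others were sent there by the Lie derivatives already expanded; no
  factorial goes with them, so their binomials stay and multiply to \<open>Dyck_C\<close>.

  Norms may be infinite, so the estimate lives in \<open>ennreal\<close> and differences are written
  as sums with a negated term.\<close>

lemma frechet_derivative_cong_open:
  assumes "open S" "x \<in> S" "\<And>y. y \<in> S \<Longrightarrow> f y = g y" "f differentiable (at x)"
  shows "g differentiable (at x)" "frechet_derivative g (at x) = frechet_derivative f (at x)"
proof -
  have "(g has_derivative frechet_derivative f (at x)) (at x)"
    using assms has_derivative_transform_within_open frechet_derivative_works by metis
  then show "g differentiable (at x)" "frechet_derivative g (at x) = frechet_derivative f (at x)"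
    by (auto simp: differentiable_def dest: frechet_derivative_at)
qed

text \<open>\<open>frechet_derivative\<close> is arbitrary where a function is not differentiable,
  so the sum and product rules are equalities on \<open>S\<close> only. Openness of \<open>S\<close>
  lets such an equality pass to the derivatives, which are taken in the full space.\<close>

lemma ck_on_cong:
  assumes "open S" "\<And>x. x \<in> S \<Longrightarrow> f x = g x" "ck_on m S f"
  shows "ck_on m S g"
  using assms(2,3)
proof (induction m arbitrary: f g)
  case 0
  then show ?case
    using continuous_on_cong by fastforce
next
  case (Suc m)
  note fr = frechet_derivative_cong_open[OF assms(1) _ Suc.prems(1)]
  have "g differentiable (at x)" if "x \<in> S" for x
    using fr that Suc.prems by auto
  moreover have "ck_on m S (\<lambda>x. frechet_derivative g (at x) v)" for v
    by (rule Suc.IH[of "\<lambda>x. frechet_derivative f (at x) v"]) (use fr Suc.prems in auto)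
  ultimately show ?case by simp
qed

lemma ck_on_Suc_imp: "ck_on (Suc m) S f \<Longrightarrow> ck_on m S f"
proof (induction m arbitrary: f)
  case 0
  then show ?case
    by (auto intro!: continuous_at_imp_continuous_on differentiable_imp_continuous_within)
qed auto

lemma ck_on_const: "ck_on m S (\<lambda>_. c)"
  by (induction m arbitrary: c) auto

lemma ck_on_add:
  assumes "open S" "ck_on m S f" "ck_on m S g"
  shows "ck_on m S (\<lambda>x. f x + g x)"
  using assms(2,3)
proof (induction m arbitrary: f g)
  case 0
  then show ?case by (auto intro: continuous_intros)
next
  case (Suc m)
  have d: "((\<lambda>x. f x + g x) has_derivative
      (\<lambda>v. frechet_derivative f (at x) v + frechet_derivative g (at x) v)) (at x)"
    if "x \<in> S" for x
    using has_derivative_add Suc.prems that by (auto simp: frechet_derivative_works)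
  have "ck_on m S (\<lambda>x. frechet_derivative (\<lambda>x. f x + g x) (at x) v)" for v
    by (rule ck_on_cong[OF assms(1), of
          "\<lambda>x. frechet_derivative f (at x) v + frechet_derivative g (at x) v"])
      (use Suc in \<open>auto simp flip: frechet_derivative_at[OF d]\<close>)
  then show ?case using Suc.prems by auto
qed

lemma ck_on_mult:
  fixes f g :: "'e::euclidean_space \<Rightarrow> real"
  assumes "open S" "ck_on m S f" "ck_on m S g"
  shows "ck_on m S (\<lambda>x. f x * g x)"
  using assms(2,3)
proof (induction m arbitrary: f g)
  case 0
  then show ?case by (auto intro: continuous_intros)
next
  case (Suc m)
  have d: "((\<lambda>x. f x * g x) has_derivative
      (\<lambda>v. f x * frechet_derivative g (at x) v + frechet_derivative f (at x) v * g x)) (at x)"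
    if "x \<in> S" for x
    using has_derivative_mult[of f _ x UNIV g] Suc.prems that
    by (auto simp: frechet_derivative_works)
  have "ck_on m S (\<lambda>x. frechet_derivative (\<lambda>x. f x * g x) (at x) v)" for v
  proof (rule ck_on_cong[OF assms(1), of
        "\<lambda>x. f x * frechet_derivative g (at x) v + frechet_derivative f (at x) v * g x"])
    show "f x * frechet_derivative g (at x) v + frechet_derivative f (at x) v * g x
        = frechet_derivative (\<lambda>x. f x * g x) (at x) v" if "x \<in> S" for x
      using frechet_derivative_at[OF d[OF that]] by metis
    show "ck_on m S
      (\<lambda>x. f x * frechet_derivative g (at x) v + frechet_derivative f (at x) v * g x)"
      using Suc.prems Suc.prems[THEN ck_on_Suc_imp]
      by (intro ck_on_add[OF assms(1)] Suc.IH) auto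
  qed
  then show ?case using Suc.prems by auto
qed

locale manifold =
  fixes M :: "('a::{t2_space, second_countable_topology}, 'n::finite) atlas"
  assumes mfd: "smooth_manifold M"
begin

abbreviation "V \<equiv> vector_fields M"
abbreviation "T \<equiv> tensor_fields M"

lemma chart:
  assumes "(U, \<phi>) \<in> M"
  shows "open U" "open (\<phi> ` U)" "homeomorphism U (\<phi> ` U) \<phi> (inv_into U \<phi>)"
  using mfd assms unfolding smooth_manifold_def by blast+

lemma smooth_add:
  assumes "f \<in> smooth_functions M" "h \<in> smooth_functions M"
  shows "(\<lambda>x. f x + h x) \<in> smooth_functions M"
  using assms chart(2) unfolding smooth_functions_def smooth_on_def comp_def
  by (fastforce intro: ck_on_add)

lemma smooth_mult:
  assumes "f \<in> smooth_functions M" "h \<in> smooth_functions M"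
  shows "(\<lambda>x. f x * h x) \<in> smooth_functions M"
  using assms chart(2) unfolding smooth_functions_def smooth_on_def comp_def
  by (fastforce intro: ck_on_mult)

lemma smooth_const: "(\<lambda>_. c) \<in> smooth_functions M"
  unfolding smooth_functions_def smooth_on_def comp_def by (auto intro: ck_on_const)

text \<open>Charts are homeomorphisms whose open domains cover the manifold, so continuity in
  coordinates glues. This feeds the semicontinuity of the pointwise norm.\<close>

lemma smooth_continuous:
  assumes "f \<in> smooth_functions M"
  shows "continuous_on UNIV f"
proof -
  have "continuous_on U f" if "(U, \<phi>) \<in> M" for U \<phi>
  proof -
    have "smooth_on (\<phi> ` U) (f \<circ> inv_into U \<phi>)"
      using assms that unfolding smooth_functions_def by blast
    then have "continuous_on (\<phi> ` U) (f \<circ> inv_into U \<phi>)"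
      unfolding smooth_on_def using ck_on.simps(1) by blast
    moreover have "continuous_on U \<phi>"
      using chart(3)[OF that] by (simp add: homeomorphism_def)
    ultimately have "continuous_on U ((f \<circ> inv_into U \<phi>) \<circ> \<phi>)"
      using continuous_on_compose by blast
    then show ?thesis
      using chart(3)[OF that] by (auto simp: homeomorphism_def cong: continuous_on_cong)
  qed
  then have "continuous_on (\<Union>U\<in>fst ` M. U) f"
    using chart(1) by (intro continuous_on_open_UN) force+
  moreover have "(\<Union>U\<in>fst ` M. U) = UNIV"
    using mfd unfolding smooth_manifold_def by force
  ultimately show ?thesis by simp
qed

lemma tangent_add:
  assumes "v \<in> tangent_space M p" "w \<in> tangent_space M p"
  shows "v + w \<in> tangent_space M p"
  using assms unfolding tangent_space_def by (auto simp: algebra_simps)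

lemma tangent_scale:
  assumes "v \<in> tangent_space M p"
  shows "(\<lambda>f. c * v f) \<in> tangent_space M p"
  using assms unfolding tangent_space_def by (auto simp: algebra_simps)

lemma vector_fields_tangent: "\<xi> \<in> V \<Longrightarrow> \<xi> p \<in> tangent_space M p"
  unfolding vector_fields_def by blast

lemma vector_fields_add: "\<xi> \<in> V \<Longrightarrow> \<eta> \<in> V \<Longrightarrow> \<xi> + \<eta> \<in> V"
  using tangent_add smooth_add unfolding vector_fields_def by (auto simp: plus_fun_def)

lemma vector_fields_fmult: "f \<in> smooth_functions M \<Longrightarrow> \<xi> \<in> V \<Longrightarrow> fmult f \<xi> \<in> V"
  using tangent_scale smooth_mult unfolding vector_fields_def fmult_def by auto

lemma vector_fields_zero: "0 \<in> V"
  using smooth_const unfolding vector_fields_def tangent_space_def by (auto simp: zero_fun_def)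

lemma vector_fields_uminus:
  assumes "\<xi> \<in> V"
  shows "- \<xi> \<in> V"
proof -
  have "- \<xi> = fmult (\<lambda>_. - 1) \<xi>" by (auto simp: fmult_def fun_eq_iff)
  then show ?thesis using vector_fields_fmult[OF smooth_const assms] by simp
qed

lemma vector_fields_diff: "\<xi> \<in> V \<Longrightarrow> \<eta> \<in> V \<Longrightarrow> \<xi> - \<eta> \<in> V"
  using vector_fields_add[of \<xi> "- \<eta>"] vector_fields_uminus by simp

lemma vector_fields_sum: "(\<And>i. i \<in> I \<Longrightarrow> F i \<in> V) \<Longrightarrow> (\<Sum>i\<in>I. F i) \<in> V"
  by (induction I rule: infinite_finite_induct) (auto intro: vector_fields_zero vector_fields_add)

lemma vector_field_apply_smooth:
  "\<xi> \<in> V \<Longrightarrow> f \<in> smooth_functions M \<Longrightarrow> (\<lambda>p. \<xi> p f) \<in> smooth_functions M"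
  unfolding vector_fields_def by blast

end


section \<open>Tensor fields\<close>

text \<open>Unification leaves eta-expanded vector fields in goals, on which these simplification rules
  would turn sums of vector fields into pointwise sums.\<close>
declare plus_fun_apply [simp del] zero_fun_apply [simp del] minus_apply [simp del]
  uminus_apply [simp del]

lemmas fun_op_apply = plus_fun_apply zero_fun_apply minus_apply uminus_apply

text \<open>The correction terms in the covariant derivative of a multilinear map. The values lie in
  any commutative monoid because \<open>F\<close> may yield vector fields or, in
  \<open>nabla_pow_eq\<close>, whole tensors.\<close>

definition deriv_args :: "('b \<Rightarrow> 'b) \<Rightarrow> ('b list \<Rightarrow> 'c::comm_monoid_add) \<Rightarrow> 'b list \<Rightarrow> 'c" where
  "deriv_args d F zs = (\<Sum>i<length zs. F (zs[i := d (zs ! i)]))"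

lemma deriv_args_Nil [simp]: "deriv_args d F [] = 0"
  by (simp add: deriv_args_def)

lemma deriv_args_Cons:
  "deriv_args d F (x # xs) = F (d x # xs) + deriv_args d (\<lambda>ys. F (x # ys)) xs"
  unfolding deriv_args_def by (simp add: sum.lessThan_Suc_shift del: sum.lessThan_Suc)

lemma deriv_args_append:
  "deriv_args d F (as @ bs)
    = deriv_args d (\<lambda>xs. F (xs @ bs)) as + deriv_args d (\<lambda>xs. F (as @ xs)) bs"
  by (induction as arbitrary: F) (simp_all add: deriv_args_Cons add.assoc)

text \<open>Insertions agree with their formula only on lists of vector fields of the right length,
  so agreement is asked only there; \<open>d\<close> has to preserve \<open>S\<close> because its
  values enter the updated lists.\<close>

lemma deriv_args_cong:
  assumes "set xs \<subseteq> S" "\<And>z. z \<in> S \<Longrightarrow> d z \<in> S"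
    "\<And>ys. length ys = length xs \<Longrightarrow> set ys \<subseteq> S \<Longrightarrow> F ys = G ys"
  shows "deriv_args d F xs = deriv_args d G xs"
  unfolding deriv_args_def
proof (rule sum.cong)
  fix i assume i: "i \<in> {..<length xs}"
  then have "set (xs[i := d (xs ! i)]) \<subseteq> S"
    using assms(1,2) nth_mem by (intro set_update_subsetI) blast+
  then show "F (xs[i := d (xs ! i)]) = G (xs[i := d (xs ! i)])"
    by (intro assms(3)) auto
qed simp

lemma deriv_args_add:
  "deriv_args d (\<lambda>x. F x + G x) xs = deriv_args d F xs + deriv_args d G xs"
  by (simp add: deriv_args_def sum.distrib)

text \<open>Position \<open>i\<close> of \<open>permute_list \<pi> zs\<close> shows entry
  \<open>\<pi> i\<close>, so entry \<open>j\<close> is found at \<open>inv \<pi> j\<close>.\<close>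

lemma permute_list_update:
  assumes "\<pi> permutes {..<length zs}" "j < length zs"
  shows "permute_list \<pi> (zs[j := x]) = (permute_list \<pi> zs)[inv \<pi> j := x]"
proof (rule nth_equalityI)
  fix i assume "i < length (permute_list \<pi> (zs[j := x]))"
  then have i: "i < length zs" by simp
  moreover have "\<pi> i < length zs"
    using permutes_in_image[OF assms(1), of i] i by simp
  moreover have "\<pi> i = j \<longleftrightarrow> i = inv \<pi> j"
    using permutes_inverses[OF assms(1)] by metis
  ultimately show "permute_list \<pi> (zs[j := x]) ! i = (permute_list \<pi> zs)[inv \<pi> j := x] ! i"
    using assms(1) by (auto simp: permute_list_nth nth_list_update)
qed simp

text \<open>The sum runs over all slots, so a permutation of the arguments merely reindexes
  it.\<close>

lemma deriv_args_permute:
  assumes "\<pi> permutes {..<length zs}"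
  shows "deriv_args d (\<lambda>zs. F (permute_list \<pi> zs)) zs = deriv_args d F (permute_list \<pi> zs)"
proof -
  have inv: "inv \<pi> permutes {..<length zs}"
    using permutes_inv[OF assms] .
  have "F (permute_list \<pi> (zs[j := d (zs ! j)]))
      = F ((permute_list \<pi> zs)[inv \<pi> j := d (permute_list \<pi> zs ! inv \<pi> j)])"
    if "j < length zs" for j
  proof -
    have "inv \<pi> j < length zs"
      using permutes_in_image[OF inv, of j] that by simp
    then show ?thesis
      using permute_list_update[OF assms that] permutes_inverses[OF assms]
      by (simp add: permute_list_nth[OF assms])
  qed
  then have "deriv_args d (\<lambda>zs. F (permute_list \<pi> zs)) zs
      = (\<Sum>j<length zs. F ((permute_list \<pi> zs)[inv \<pi> j := d (permute_list \<pi> zs ! inv \<pi> j)]))"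
    by (simp add: deriv_args_def)
  also have "\<dots> = (\<Sum>j<length zs. F ((permute_list \<pi> zs)[j := d (permute_list \<pi> zs ! j)]))"
    using sum.permute[OF inv, of "\<lambda>j. F ((permute_list \<pi> zs)[j := d (permute_list \<pi> zs ! j)])"]
    by (simp add: comp_def)
  finally show ?thesis by (simp add: deriv_args_def)
qed

lemma fmult_add: "fmult f (\<xi> + \<eta>) = fmult f \<xi> + fmult f \<eta>"
  by (auto simp: fmult_def fun_eq_iff fun_op_apply algebra_simps)

lemma fmult_diff: "fmult f (\<xi> - \<eta>) = fmult f \<xi> - fmult f \<eta>"
  by (auto simp: fmult_def fun_eq_iff fun_op_apply algebra_simps)

lemma fmult_uminus: "fmult f (- \<xi>) = - fmult f \<xi>"
  by (auto simp: fmult_def fun_eq_iff fun_op_apply)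

lemma fmult_zero [simp]: "fmult f 0 = 0"
  by (auto simp: fmult_def fun_eq_iff fun_op_apply)

lemma fmult_minus_one: "fmult (\<lambda>_. - 1) \<xi> = - \<xi>"
  by (auto simp: fmult_def fun_eq_iff fun_op_apply)

lemma fmult_sum: "fmult f (\<Sum>i\<in>I. F i) = (\<Sum>i\<in>I. fmult f (F i))"
  using sum_comp_morphism[of "fmult f" F I, OF fmult_zero fmult_add] by (simp add: comp_def)

lemma deriv_args_fmult: "deriv_args d (\<lambda>x. fmult f (F x)) xs = fmult f (deriv_args d F xs)"
  by (simp add: deriv_args_def fmult_sum)

context manifold
begin

lemma tensor_zero: "u \<in> T q \<Longrightarrow> \<not> (length zs = q \<and> set zs \<subseteq> V) \<Longrightarrow> u zs = 0"
  unfolding tensor_fields_def by blast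

lemma tensor_closed: "u \<in> T q \<Longrightarrow> u zs \<in> V"
  using vector_fields_zero unfolding tensor_fields_def by (cases "length zs = q \<and> set zs \<subseteq> V") auto

text \<open>The split form \<open>as @ \<xi> # bs\<close> matches the way insertions decompose
  argument lists. At lists of the wrong length both sides are the extension by zero.\<close>

lemma tensor_add:
  assumes "u \<in> T q" "set as \<subseteq> V" "set bs \<subseteq> V" "\<xi> \<in> V" "\<eta> \<in> V"
  shows "u (as @ (\<xi> + \<eta>) # bs) = u (as @ \<xi> # bs) + u (as @ \<eta> # bs)"
proof (cases "length (as @ \<xi> # bs) = q")
  case True
  have "\<forall>i<q. \<forall>\<xi>'\<in>V. \<forall>\<eta>\<in>V. u ((as @ \<xi> # bs)[i := \<xi>' + \<eta>])
      = u ((as @ \<xi> # bs)[i := \<xi>']) + u ((as @ \<xi> # bs)[i := \<eta>])"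
    using assms True unfolding tensor_fields_def by auto
  from this[rule_format, of "length as" \<xi> \<eta>] show ?thesis
    using assms True by auto
next
  case False
  then show ?thesis using tensor_zero[OF assms(1)] by auto
qed

lemma tensor_fmult:
  assumes "u \<in> T q" "set as \<subseteq> V" "set bs \<subseteq> V" "\<xi> \<in> V" "f \<in> smooth_functions M"
  shows "u (as @ fmult f \<xi> # bs) = fmult f (u (as @ \<xi> # bs))"
proof (cases "length (as @ \<xi> # bs) = q")
  case True
  have "\<forall>i<q. \<forall>\<xi>'\<in>V. \<forall>f\<in>smooth_functions M. u ((as @ \<xi> # bs)[i := fmult f \<xi>'])
      = fmult f (u ((as @ \<xi> # bs)[i := \<xi>']))"
    using assms True unfolding tensor_fields_def by auto
  from this[rule_format, of "length as" \<xi> f] show ?thesis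
    using assms True by auto
next
  case False
  then show ?thesis using tensor_zero[OF assms(1)] by auto
qed

lemma tensorI:
  assumes "\<And>zs. \<not> (length zs = q \<and> set zs \<subseteq> V) \<Longrightarrow> u zs = 0"
    "\<And>zs. length zs = q \<Longrightarrow> set zs \<subseteq> V \<Longrightarrow> u zs \<in> V"
    "\<And>as bs \<xi> \<eta>. length as + Suc (length bs) = q \<Longrightarrow> set as \<subseteq> V \<Longrightarrow> set bs \<subseteq> V \<Longrightarrow> \<xi> \<in> V \<Longrightarrow> \<eta> \<in> V
      \<Longrightarrow> u (as @ (\<xi> + \<eta>) # bs) = u (as @ \<xi> # bs) + u (as @ \<eta> # bs)"
    "\<And>as bs \<xi> f. length as + Suc (length bs) = q \<Longrightarrow> set as \<subseteq> V \<Longrightarrow> set bs \<subseteq> V \<Longrightarrow> \<xi> \<in> V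
      \<Longrightarrow> f \<in> smooth_functions M \<Longrightarrow> u (as @ fmult f \<xi> # bs) = fmult f (u (as @ \<xi> # bs))"
  shows "u \<in> T q"
proof -
  have sub: "set (take i zs) \<subseteq> V" "set (drop j zs) \<subseteq> V" if "set zs \<subseteq> V" for i j zs
    using that set_take_subset set_drop_subset by fastforce+
  have "u (zs[i := \<xi> + \<eta>]) = u (zs[i := \<xi>]) + u (zs[i := \<eta>])"
    if "length zs = q" "set zs \<subseteq> V" "i < q" "\<xi> \<in> V" "\<eta> \<in> V" for zs i \<xi> \<eta>
    using assms(3)[of "take i zs" "drop (Suc i) zs" \<xi> \<eta>] that sub
    by (simp add: upd_conv_take_nth_drop)
  moreover have "u (zs[i := fmult f \<xi>]) = fmult f (u (zs[i := \<xi>]))"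
    if "length zs = q" "set zs \<subseteq> V" "i < q" "\<xi> \<in> V" "f \<in> smooth_functions M" for zs i \<xi> f
    using assms(4)[of "take i zs" "drop (Suc i) zs" \<xi> f] that sub
    by (simp add: upd_conv_take_nth_drop)
  ultimately show ?thesis
    using assms(1,2) unfolding tensor_fields_def by blast
qed

lemma tensor_eqI:
  assumes "u \<in> T q" "v \<in> T q" "\<And>zs. length zs = q \<Longrightarrow> set zs \<subseteq> V \<Longrightarrow> u zs = v zs"
  shows "u = v"
  using assms tensor_zero by (metis ext)

lemma tensor_uminus:
  assumes "u \<in> T q" "set as \<subseteq> V" "set bs \<subseteq> V" "\<xi> \<in> V"
  shows "u (as @ (- \<xi>) # bs) = - u (as @ \<xi> # bs)"
  using tensor_fmult[OF assms smooth_const, of "- 1"] by (simp only: fmult_minus_one)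

lemma tensor_diff:
  assumes "u \<in> T q" "set as \<subseteq> V" "set bs \<subseteq> V" "\<xi> \<in> V" "\<eta> \<in> V"
  shows "u (as @ (\<xi> - \<eta>) # bs) = u (as @ \<xi> # bs) - u (as @ \<eta> # bs)"
  using tensor_add[OF assms(1-4), of "- \<eta>"] tensor_uminus[OF assms(1-3,5)] assms(5)
  by (simp add: vector_fields_uminus)

lemma tensor_sum:
  assumes "u \<in> T q" "set as \<subseteq> V" "set bs \<subseteq> V" "\<And>i. i \<in> I \<Longrightarrow> F i \<in> V"
  shows "u (as @ (\<Sum>i\<in>I. F i) # bs) = (\<Sum>i\<in>I. u (as @ F i # bs))"
proof -
  \<comment> \<open>Serves both the empty and the infinite index set, whose sums are 0.\<close>
  have z: "u (as @ 0 # bs) = 0"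
    using tensor_diff[OF assms(1-3) vector_fields_zero vector_fields_zero] by simp
  show ?thesis
    using assms(4)
  proof (induction I rule: infinite_finite_induct)
    case (insert i I)
    have "u (as @ (F i + (\<Sum>i\<in>I. F i)) # bs) = u (as @ F i # bs) + u (as @ (\<Sum>i\<in>I. F i) # bs)"
      by (intro tensor_add[OF assms(1-3)] vector_fields_sum) (use insert.prems in auto)
    then show ?case using insert by simp
  qed (use z in auto)
qed

lemma tensor_plus_closed:
  assumes "u \<in> T q" "v \<in> T q"
  shows "u + v \<in> T q"
proof (rule tensorI)
  show "(u + v) zs = 0" if "\<not> (length zs = q \<and> set zs \<subseteq> V)" for zs
    using assms[THEN tensor_zero, OF that] by (simp add: plus_fun_apply)
  show "(u + v) zs \<in> V" for zs
    using assms[THEN tensor_closed] by (simp add: plus_fun_apply vector_fields_add)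
  show "(u + v) (as @ (\<xi> + \<eta>) # bs) = (u + v) (as @ \<xi> # bs) + (u + v) (as @ \<eta> # bs)"
    if "set as \<subseteq> V" "set bs \<subseteq> V" "\<xi> \<in> V" "\<eta> \<in> V" for as bs \<xi> \<eta>
    using assms[THEN tensor_add, OF that] plus_fun_apply[of u v] by (simp add: ac_simps)
  show "(u + v) (as @ fmult f \<xi> # bs) = fmult f ((u + v) (as @ \<xi> # bs))"
    if "set as \<subseteq> V" "set bs \<subseteq> V" "\<xi> \<in> V" "f \<in> smooth_functions M" for as bs \<xi> f
    using assms[THEN tensor_fmult, OF that] plus_fun_apply[of u v] by (simp add: fmult_add)
qed

lemma tensor_uminus_closed:
  assumes "u \<in> T q"
  shows "- u \<in> T q"
proof (rule tensorI)
  show "(- u) zs = 0" if "\<not> (length zs = q \<and> set zs \<subseteq> V)" for zs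
    using assms[THEN tensor_zero, OF that] by (simp add: uminus_apply)
  show "(- u) zs \<in> V" for zs
    using assms[THEN tensor_closed] by (simp add: uminus_apply vector_fields_uminus)
  show "(- u) (as @ (\<xi> + \<eta>) # bs) = (- u) (as @ \<xi> # bs) + (- u) (as @ \<eta> # bs)"
    if "set as \<subseteq> V" "set bs \<subseteq> V" "\<xi> \<in> V" "\<eta> \<in> V" for as bs \<xi> \<eta>
    using assms[THEN tensor_add, OF that] uminus_apply[of u] by simp
  show "(- u) (as @ fmult f \<xi> # bs) = fmult f ((- u) (as @ \<xi> # bs))"
    if "set as \<subseteq> V" "set bs \<subseteq> V" "\<xi> \<in> V" "f \<in> smooth_functions M" for as bs \<xi> f
    using assms[THEN tensor_fmult, OF that] uminus_apply[of u] by (simp add: fmult_uminus)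
qed

lemma tensor_diff_closed: "u \<in> T q \<Longrightarrow> v \<in> T q \<Longrightarrow> u - v \<in> T q"
  using tensor_plus_closed[OF _ tensor_uminus_closed] by fastforce

lemma vector_tensor_closed: "\<xi> \<in> V \<Longrightarrow> vector_tensor \<xi> \<in> T 0"
  by (rule tensorI) (auto simp: vector_tensor_def)

lemma tensor_permute_closed:
  assumes "w \<in> T q" "\<pi> permutes {..<q}"
  shows "(\<lambda>zs. w (permute_list \<pi> zs)) \<in> T q"
proof -
  have "w (permute_list \<pi> zs) = 0" if "\<not> (length zs = q \<and> set zs \<subseteq> V)" for zs
    using that assms by (intro tensor_zero[OF assms(1)]) auto
  moreover have "w (permute_list \<pi> (zs[i := \<xi> + \<eta>]))
      = w (permute_list \<pi> (zs[i := \<xi>])) + w (permute_list \<pi> (zs[i := \<eta>]))"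
    and "f \<in> smooth_functions M \<Longrightarrow>
      w (permute_list \<pi> (zs[i := fmult f \<xi>])) = fmult f (w (permute_list \<pi> (zs[i := \<xi>])))"
    if "length zs = q" "set zs \<subseteq> V" "i < q" "\<xi> \<in> V" "\<eta> \<in> V" for zs i \<xi> \<eta> f
  proof -
    have "set (permute_list \<pi> zs) \<subseteq> V" "length (permute_list \<pi> zs) = q"
      using that assms(2) by auto
    moreover have "inv \<pi> i < q"
      using permutes_in_image[OF permutes_inv[OF assms(2)], of i] that by simp
    ultimately show "w (permute_list \<pi> (zs[i := \<xi> + \<eta>]))
        = w (permute_list \<pi> (zs[i := \<xi>])) + w (permute_list \<pi> (zs[i := \<eta>]))"
      and "f \<in> smooth_functions M \<Longrightarrow>
        w (permute_list \<pi> (zs[i := fmult f \<xi>])) = fmult f (w (permute_list \<pi> (zs[i := \<xi>])))"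
      using assms that unfolding tensor_fields_def by (auto simp: permute_list_update)
  qed
  ultimately show ?thesis
    using tensor_closed[OF assms(1)] unfolding tensor_fields_def by blast
qed

section \<open>Insertion of one tensor into a slot of another\<close>

definition insert_at :: "nat \<Rightarrow> nat \<Rightarrow> 'a tensor \<Rightarrow> 'a tensor \<Rightarrow> 'a tensor" where
  "insert_at i n u v ws = u (take i ws @ [v (take n (drop i ws))] @ drop (i + n) ws)"

lemma insert_at_append:
  "i = length as \<Longrightarrow> n = length bs \<Longrightarrow> insert_at i n u v (as @ bs @ cs) = u (as @ v bs # cs)"
  by (simp add: insert_at_def)

lemma insert_tensor_id:
  "insert_tensor M m n i id u v =
    (\<lambda>zs. if length zs = m - 1 + n \<and> set zs \<subseteq> V then insert_at i n u v zs else 0)"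
  by (simp add: insert_tensor_def insert_at_def fun_eq_iff)

text \<open>Factoring out the order of the arguments leaves only the identity order to be computed
  with; the permutation is handled by \<open>tensor_permute_closed\<close> and
  \<open>D_permute\<close>.\<close>

lemma insert_tensor_permute:
  assumes "\<pi> permutes {..<m - 1 + n}"
  shows "insert_tensor M m n i \<pi> u v = (\<lambda>zs. insert_tensor M m n i id u v (permute_list \<pi> zs))"
proof
  fix zs :: "'a vfield list"
  show "insert_tensor M m n i \<pi> u v zs = insert_tensor M m n i id u v (permute_list \<pi> zs)"
    using assms by (cases "length zs = m - 1 + n") (auto simp: insert_tensor_def)
qed

text \<open>One entry is singled out between \<open>as\<close> and \<open>bs\<close>, and the
  \<open>n\<close> entries from position \<open>i\<close> on are fed to \<open>v\<close>. The case
  names locate that block: it lies after the entry, has the entry inside, or lies before it.\<close>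

lemma insertion_cases:
  assumes "length as + Suc (length bs) = m - 1 + n" "i < m"
  obtains (after) b1 b2 b3 where "bs = b1 @ b2 @ b3" "i = length as + Suc (length b1)" "n = length b2"
  | (inside) a1 a2 b1 b2 where "as = a1 @ a2" "bs = b1 @ b2" "i = length a1"
      "n = length a2 + Suc (length b1)"
  | (before) a1 a2 a3 where "as = a1 @ a2 @ a3" "i = length a1" "n = length a2"
proof -
  consider "length as < i" | "i \<le> length as" "length as < i + n" | "i + n \<le> length as"
    by linarith
  then show ?thesis
  proof cases
    case 1
    let ?k = "i - Suc (length as)"
    show ?thesis
      by (rule after[of "take ?k bs" "take n (drop ?k bs)" "drop n (drop ?k bs)"])
        (use assms 1 in \<open>auto simp flip: drop_drop\<close>)
  next
    case 2
    show ?thesis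
      by (rule inside[of "take i as" "drop i as" "take (i + n - Suc (length as)) bs"
            "drop (i + n - Suc (length as)) bs"]) (use assms 2 in auto)
  next
    case 3
    show ?thesis
      by (rule before[of "take i as" "take n (drop i as)" "drop n (drop i as)"])
        (use assms 3 in \<open>auto simp: add.commute simp flip: drop_drop\<close>)
  qed
qed

lemma insert_at_closed: "u \<in> T m \<Longrightarrow> insert_at i n u v ws \<in> V"
  by (simp add: insert_at_def tensor_closed)

text \<open>An entry is an argument either of \<open>u\<close> or of \<open>v\<close>; in the second
  case the linearity of \<open>v\<close> is passed on through slot \<open>i\<close> of
  \<open>u\<close>.\<close>

lemma insert_id_closed:
  assumes u: "u \<in> T m" and v: "v \<in> T n" and "i < m"
  shows "insert_tensor M m n i id u v \<in> T (m - 1 + n)"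
proof -
  have "insert_at i n u v (as @ (\<xi> + \<eta>) # bs)
      = insert_at i n u v (as @ \<xi> # bs) + insert_at i n u v (as @ \<eta> # bs)
    \<and> (\<forall>f\<in>smooth_functions M. insert_at i n u v (as @ fmult f \<xi> # bs)
      = fmult f (insert_at i n u v (as @ \<xi> # bs)))"
    if *: "length as + Suc (length bs) = m - 1 + n" "set as \<subseteq> V" "set bs \<subseteq> V" "\<xi> \<in> V" "\<eta> \<in> V"
    for as bs \<xi> \<eta>
    using *(1) assms(3)
  proof (cases rule: insertion_cases)
    case (after b1 b2 b3)
    have "insert_at i n u v (as @ x # bs) = u (as @ x # (b1 @ v b2 # b3))" for x
      using insert_at_append[of i "as @ x # b1" n b2] after by simp
    moreover have "set (b1 @ v b2 # b3) \<subseteq> V"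
      using * after tensor_closed[OF v] by simp
    ultimately show ?thesis
      using tensor_add[OF u *(2)] tensor_fmult[OF u *(2)] *(4,5) by simp
  next
    case (inside a1 a2 b1 b2)
    have "insert_at i n u v (as @ x # bs) = u (a1 @ v (a2 @ x # b1) # b2)" for x
      using insert_at_append[of i a1 n "a2 @ x # b1"] inside by simp
    then show ?thesis
      using * inside by (simp add: tensor_add[OF v] tensor_add[OF u] tensor_fmult[OF v]
          tensor_fmult[OF u] tensor_closed[OF v])
  next
    case (before a1 a2 a3)
    have "insert_at i n u v (as @ x # bs) = u ((a1 @ v a2 # a3) @ x # bs)" for x
      using insert_at_append[of i a1 n a2 _ _ "a3 @ x # bs"] before by simp
    moreover have "set (a1 @ v a2 # a3) \<subseteq> V"
      using * before tensor_closed[OF v] by simp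
    ultimately show ?thesis
      using tensor_add[OF u _ *(3)] tensor_fmult[OF u _ *(3)] *(4,5) by metis
  qed
  then show ?thesis
    unfolding insert_tensor_id
    by (intro tensorI)
      (simp_all add: vector_fields_add vector_fields_fmult
        insert_at_closed[OF u], blast+)
qed

lemma insert_tensor_closed:
  assumes "u \<in> T m" "v \<in> T n" "i < m" "\<pi> permutes {..<m - 1 + n}"
  shows "insert_tensor M m n i \<pi> u v \<in> T (m - 1 + n)"
  unfolding insert_tensor_permute[OF assms(4)]
  by (intro tensor_permute_closed insert_id_closed assms)

end


section \<open>Total covariant derivatives\<close>

text \<open>The operator that raises the rank by one and whose iterates are the tensors
  \<open>nabla_pow\<close>, see \<open>nabla_pow_eq\<close>. Unlike the recursion of
  \<open>nabla_along\<close> it composes as a plain power.\<close>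

definition total_nabla ::
    "('a, 'n::finite) atlas \<Rightarrow> ('a vfield \<Rightarrow> 'a vfield \<Rightarrow> 'a vfield) \<Rightarrow> 'a tensor \<Rightarrow> 'a tensor" where
  "total_nabla M nab u = (\<lambda>zs.
     if zs \<noteq> [] \<and> set zs \<subseteq> vector_fields M then tensor_nabla M nab (hd zs) u (tl zs) else 0)"

text \<open>The order of the arguments after differentiation: the new direction stays in front and
  the old arguments are permuted as before.\<close>

definition lift_perm :: "(nat \<Rightarrow> nat) \<Rightarrow> nat \<Rightarrow> nat" where
  "lift_perm \<pi> j = (case j of 0 \<Rightarrow> 0 | Suc j \<Rightarrow> Suc (\<pi> j))"

lemma lift_perm_permutes:
  assumes "\<pi> permutes {..<n}"
  shows "lift_perm \<pi> permutes {..<Suc n}"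
proof (rule bij_imp_permutes)
  have "inj_on (lift_perm \<pi>) {..<Suc n}"
  proof (rule inj_onI)
    fix x y assume "lift_perm \<pi> x = lift_perm \<pi> y"
    then show "x = y"
      using injD[OF permutes_inj[OF assms]] by (cases x; cases y) (simp_all add: lift_perm_def)
  qed
  moreover have "lift_perm \<pi> ` {..<Suc n} \<subseteq> {..<Suc n}"
  proof -
    have "\<pi> j < n" if "j < n" for j
      using permutes_in_image[OF assms, of j] that by simp
    moreover have "lift_perm \<pi> x = (if x = 0 then 0 else Suc (\<pi> (x - 1)))" for x
      by (cases x) (simp_all add: lift_perm_def)
    ultimately show ?thesis by auto
  qed
  ultimately show "bij_betw (lift_perm \<pi>) {..<Suc n} {..<Suc n}"
    by (simp add: bij_betw_def endo_inj_surj)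
  show "lift_perm \<pi> x = x" if "x \<notin> {..<Suc n}" for x
  proof (cases x)
    case (Suc y)
    then show ?thesis
      using that permutes_not_in[OF assms, of y] by (simp add: lift_perm_def)
  qed (use that in simp)
qed

lemma permute_list_lift_perm:
  assumes "\<pi> permutes {..<length zs}"
  shows "permute_list (lift_perm \<pi>) (x # zs) = x # permute_list \<pi> zs"
proof (rule nth_equalityI)
  fix i assume "i < length (permute_list (lift_perm \<pi>) (x # zs))"
  then show "permute_list (lift_perm \<pi>) (x # zs) ! i = (x # permute_list \<pi> zs) ! i"
    using lift_perm_permutes[OF assms] assms
    by (cases i) (auto simp: permute_list_nth lift_perm_def)
qed simp

text \<open>Carries the leading argument to position \<open>i\<close>. In an insertion of
  \<open>D v\<close> the direction is the first argument of \<open>v\<close>, hence at position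
  \<open>i\<close>, while the derivative of the insertion lists it first.\<close>

definition front_cycle :: "nat \<Rightarrow> nat \<Rightarrow> nat" where
  "front_cycle i j = (if j < i then Suc j else if j = i then 0 else j)"

lemma front_cycle_permutes:
  assumes "i < n"
  shows "front_cycle i permutes {..<n}"
proof (rule bij_imp_permutes)
  have "inj_on (front_cycle i) {..<n}"
    by (auto simp: inj_on_def front_cycle_def split: if_splits)
  moreover have "front_cycle i ` {..<n} \<subseteq> {..<n}"
    using assms by (auto simp: front_cycle_def)
  ultimately show "bij_betw (front_cycle i) {..<n} {..<n}"
    by (simp add: bij_betw_def endo_inj_surj)
  show "front_cycle i x = x" if "x \<notin> {..<n}" for x
    using that assms by (auto simp: front_cycle_def)
qed

lemma permute_list_front_cycle:
  "permute_list (front_cycle (length as)) (x # as @ bs) = as @ x # bs"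
proof (rule nth_equalityI)
  fix i assume i: "i < length (permute_list (front_cycle (length as)) (x # as @ bs))"
  have "front_cycle (length as) permutes {..<length (x # as @ bs)}"
    by (rule front_cycle_permutes) simp
  then show "permute_list (front_cycle (length as)) (x # as @ bs) ! i = (as @ x # bs) ! i"
    using i by (auto simp: permute_list_nth front_cycle_def nth_append nth_Cons' not_less)
qed simp

locale manifold_connection = manifold M
  for M :: "('a::{t2_space, second_countable_topology}, 'n::finite) atlas" +
  fixes nab :: "'a vfield \<Rightarrow> 'a vfield \<Rightarrow> 'a vfield"
  assumes conn: "connection M nab"
begin

abbreviation "D \<equiv> total_nabla M nab"

lemma nab_closed: "\<xi> \<in> V \<Longrightarrow> \<eta> \<in> V \<Longrightarrow> nab \<xi> \<eta> \<in> V"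
  using conn unfolding connection_def by blast

lemma nab_add:
  assumes "\<xi> \<in> V" "\<xi>' \<in> V" "\<eta> \<in> V"
  shows "nab (\<xi> + \<xi>') \<eta> = nab \<xi> \<eta> + nab \<xi>' \<eta>" "nab \<eta> (\<xi> + \<xi>') = nab \<eta> \<xi> + nab \<eta> \<xi>'"
  using conn assms unfolding connection_def by blast+

lemma nab_fmult:
  assumes "f \<in> smooth_functions M" "\<xi> \<in> V" "\<eta> \<in> V"
  shows "nab (fmult f \<xi>) \<eta> = fmult f (nab \<xi> \<eta>)"
    "nab \<xi> (fmult f \<eta>) = fmult (\<lambda>p. \<xi> p f) \<eta> + fmult f (nab \<xi> \<eta>)"
  using conn assms unfolding connection_def by blast+

lemma nab_diff:
  assumes "\<xi> \<in> V" "\<xi>' \<in> V" "\<eta> \<in> V"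
  shows "nab \<eta> (\<xi> - \<xi>') = nab \<eta> \<xi> - nab \<eta> \<xi>'"
  using nab_add(2)[of "\<xi> - \<xi>'" \<xi>' \<eta>] assms vector_fields_diff by (simp add: eq_diff_eq)

lemma D_Cons:
  "X \<in> V \<Longrightarrow> set zs \<subseteq> V \<Longrightarrow> D u (X # zs) = nab X (u zs) - deriv_args (nab X) u zs"
  by (simp add: total_nabla_def tensor_nabla_def deriv_args_def)

lemma deriv_args_nab_cong:
  assumes "X \<in> V" "set xs \<subseteq> V"
    "\<And>ys. length ys = length xs \<Longrightarrow> set ys \<subseteq> V \<Longrightarrow> F ys = G ys"
  shows "deriv_args (nab X) F xs = deriv_args (nab X) G xs"
  by (rule deriv_args_cong[of _ V]) (use assms nab_closed in auto)

text \<open>Linearity in the direction over smooth functions, for the first argument of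
  \<open>D u\<close>.\<close>

lemma deriv_args_dir:
  assumes u: "u \<in> T q" and "set zs \<subseteq> V" "X \<in> V" "Y \<in> V"
  shows "deriv_args (nab (X + Y)) u zs = deriv_args (nab X) u zs + deriv_args (nab Y) u zs"
    "f \<in> smooth_functions M \<Longrightarrow> deriv_args (nab (fmult f X)) u zs = fmult f (deriv_args (nab X) u zs)"
proof -
  have *: "u (zs[i := nab (X + Y) (zs ! i)]) = u (zs[i := nab X (zs ! i)]) + u (zs[i := nab Y (zs ! i)])"
    "f \<in> smooth_functions M \<Longrightarrow> u (zs[i := nab (fmult f X) (zs ! i)]) = fmult f (u (zs[i := nab X (zs ! i)]))"
    if "i < length zs" for i
  proof -
    have "zs ! i \<in> V" "set (take i zs) \<subseteq> V" "set (drop (Suc i) zs) \<subseteq> V"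
      using assms(2) that nth_mem set_take_subset set_drop_subset by fastforce+
    then show "u (zs[i := nab (X + Y) (zs ! i)]) = u (zs[i := nab X (zs ! i)]) + u (zs[i := nab Y (zs ! i)])"
      "f \<in> smooth_functions M \<Longrightarrow> u (zs[i := nab (fmult f X) (zs ! i)]) = fmult f (u (zs[i := nab X (zs ! i)]))"
      using assms that
      by (simp_all add: upd_conv_take_nth_drop nab_add nab_fmult tensor_add tensor_fmult nab_closed)
  qed
  then show "deriv_args (nab (X + Y)) u zs = deriv_args (nab X) u zs + deriv_args (nab Y) u zs"
    "f \<in> smooth_functions M \<Longrightarrow> deriv_args (nab (fmult f X)) u zs = fmult f (deriv_args (nab X) u zs)"
    by (simp_all add: deriv_args_def sum.distrib fmult_sum)
qed

text \<open>The term with \<open>X p f\<close> comes from the derivative of the scaled argument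
  \<open>fmult f \<xi>\<close> itself. In \<open>D_closed\<close> it cancels the same term produced
  by differentiating the value of \<open>u\<close>, and this makes \<open>D u\<close> tensorial in
  the old arguments.\<close>

lemma deriv_args_slot:
  assumes u: "u \<in> T q" and V: "set as \<subseteq> V" "set bs \<subseteq> V" "X \<in> V" "\<xi> \<in> V" "\<eta> \<in> V"
  shows "deriv_args (nab X) u (as @ (\<xi> + \<eta>) # bs)
      = deriv_args (nab X) u (as @ \<xi> # bs) + deriv_args (nab X) u (as @ \<eta> # bs)"
    "f \<in> smooth_functions M \<Longrightarrow> deriv_args (nab X) u (as @ fmult f \<xi> # bs)
      = fmult (\<lambda>p. X p f) (u (as @ \<xi> # bs)) + fmult f (deriv_args (nab X) u (as @ \<xi> # bs))"
proof -
  have split: "deriv_args (nab X) u (as @ z # bs)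
     = deriv_args (nab X) (\<lambda>xs. u (xs @ z # bs)) as + u (as @ nab X z # bs)
       + deriv_args (nab X) (\<lambda>xs. u (as @ z # xs)) bs" for z
    by (simp add: deriv_args_append deriv_args_Cons add.assoc)
  have "deriv_args (nab X) (\<lambda>xs. u (xs @ (\<xi> + \<eta>) # bs)) as
      = deriv_args (nab X) (\<lambda>xs. u (xs @ \<xi> # bs) + u (xs @ \<eta> # bs)) as"
    "deriv_args (nab X) (\<lambda>xs. u (as @ (\<xi> + \<eta>) # xs)) bs
      = deriv_args (nab X) (\<lambda>xs. u (as @ \<xi> # xs) + u (as @ \<eta> # xs)) bs"
    using V by (intro deriv_args_nab_cong; simp add: tensor_add[OF u])+
  then show "deriv_args (nab X) u (as @ (\<xi> + \<eta>) # bs)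
      = deriv_args (nab X) u (as @ \<xi> # bs) + deriv_args (nab X) u (as @ \<eta> # bs)"
    using V by (simp add: split deriv_args_add nab_add tensor_add[OF u] nab_closed)
  assume f: "f \<in> smooth_functions M"
  have "deriv_args (nab X) (\<lambda>xs. u (xs @ fmult f \<xi> # bs)) as
      = deriv_args (nab X) (\<lambda>xs. fmult f (u (xs @ \<xi> # bs))) as"
    "deriv_args (nab X) (\<lambda>xs. u (as @ fmult f \<xi> # xs)) bs
      = deriv_args (nab X) (\<lambda>xs. fmult f (u (as @ \<xi> # xs))) bs"
    using V f by (intro deriv_args_nab_cong; simp add: tensor_fmult[OF u])+
  then show "deriv_args (nab X) u (as @ fmult f \<xi> # bs)
      = fmult (\<lambda>p. X p f) (u (as @ \<xi> # bs)) + fmult f (deriv_args (nab X) u (as @ \<xi> # bs))"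
    using V f by (simp add: split deriv_args_fmult nab_fmult tensor_add[OF u] tensor_fmult[OF u]
        nab_closed vector_fields_fmult vector_field_apply_smooth fmult_add)
qed

lemma deriv_args_closed:
  assumes "u \<in> T q"
  shows "deriv_args d u zs \<in> V"
  unfolding deriv_args_def by (intro vector_fields_sum tensor_closed[OF assms])

lemma D_closed:
  assumes u: "u \<in> T q"
  shows "D u \<in> T (Suc q)"
proof (rule tensorI)
  fix zs
  show "D u zs = 0" if "\<not> (length zs = Suc q \<and> set zs \<subseteq> V)"
  proof (cases "zs \<noteq> [] \<and> set zs \<subseteq> V")
    case True
    then obtain X ys where X: "zs = X # ys" by (cases zs) auto
    then have "length ys \<noteq> q" using that True by auto
    then have "u ys = 0" "deriv_args (nab X) u ys = 0"
      using tensor_zero[OF u] by (auto simp: deriv_args_def)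
    moreover have "nab X 0 = 0"
      using nab_diff[of 0 0 X] True X vector_fields_zero by simp
    ultimately show ?thesis
      using D_Cons[of X ys] X True by simp
  qed (auto simp: total_nabla_def)
  show "D u zs \<in> V" if len: "length zs = Suc q" and "set zs \<subseteq> V"
  proof -
    obtain X ys where "zs = X # ys" using len by (cases zs) auto
    then show ?thesis
      using D_Cons[of X ys] that u
      by (simp add: vector_fields_diff nab_closed tensor_closed deriv_args_closed)
  qed
next
  fix as bs \<xi> \<eta>
  assume V: "set as \<subseteq> V" "set bs \<subseteq> V" "\<xi> \<in> V" "\<eta> \<in> V"
  note uc = tensor_closed[OF u]
  show "D u (as @ (\<xi> + \<eta>) # bs) = D u (as @ \<xi> # bs) + D u (as @ \<eta> # bs)"
  proof (cases as)
    case Nil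
    then show ?thesis
      using V by (simp add: D_Cons vector_fields_add nab_add uc deriv_args_dir[OF u])
  next
    case (Cons X as')
    then show ?thesis
      using V by (simp add: D_Cons vector_fields_add nab_add uc deriv_args_slot[OF u] tensor_add[OF u])
  qed
next
  fix as bs \<xi> f
  assume V: "set as \<subseteq> V" "set bs \<subseteq> V" "\<xi> \<in> V" "f \<in> smooth_functions M"
  note uc = tensor_closed[OF u]
  show "D u (as @ fmult f \<xi> # bs) = fmult f (D u (as @ \<xi> # bs))"
  proof (cases as)
    case Nil
    then show ?thesis
      using V by (simp add: D_Cons vector_fields_fmult nab_fmult uc deriv_args_dir[OF u] fmult_diff)
  next
    case (Cons X as')
    then show ?thesis
      using V by (simp add: D_Cons vector_fields_fmult nab_fmult uc deriv_args_slot[OF u]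
          tensor_fmult[OF u] fmult_diff)
  qed
qed

lemma D_pow_closed: "u \<in> T q \<Longrightarrow> (D ^^ s) u \<in> T (s + q)"
  by (induction s) (simp_all add: D_closed)

lemma D_add:
  assumes u: "u \<in> T q" and v: "v \<in> T q"
  shows "D (u + v) = D u + D v"
proof (rule tensor_eqI)
  show "D (u + v) \<in> T (Suc q)" "D u + D v \<in> T (Suc q)"
    using assms by (simp_all add: D_closed tensor_plus_closed)
  fix zs assume "length zs = Suc q" "set zs \<subseteq> V"
  moreover then obtain X ys where "zs = X # ys" by (cases zs) auto
  moreover have "deriv_args d (u + v) ys = deriv_args d u ys + deriv_args d v ys" for d ys
    using deriv_args_add[of d u v] by (simp add: plus_fun_def[of u v])
  ultimately show "D (u + v) zs = (D u + D v) zs"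
    using tensor_closed[OF u] tensor_closed[OF v]
    by (simp add: plus_fun_apply[of u v] plus_fun_apply[of "D u"] D_Cons nab_add)
qed

lemma D_uminus:
  assumes "u \<in> T q"
  shows "D (- u) = - D u"
proof -
  have z: "(0 :: 'a tensor) \<in> T q"
    using tensor_diff_closed[OF assms assms] by simp
  have "D 0 = D 0 + D 0"
    using D_add[OF z z] by simp
  moreover have "D u + D (- u) = D 0"
    using D_add[OF assms tensor_uminus_closed[OF assms]] by simp
  ultimately show ?thesis
    by (simp add: eq_neg_iff_add_eq_0 add.commute)
qed

lemma D_pow_add:
  "u \<in> T q \<Longrightarrow> v \<in> T q \<Longrightarrow> (D ^^ s) (u + v) = (D ^^ s) u + (D ^^ s) v"
  by (induction s) (simp_all add: D_add[OF D_pow_closed D_pow_closed])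

lemma D_pow_uminus: "u \<in> T q \<Longrightarrow> (D ^^ s) (- u) = - (D ^^ s) u"
  by (induction s) (simp_all add: D_uminus[OF D_pow_closed])

text \<open>The recursion subtracts the derivatives of the directions, and
  \<open>tensor_nabla\<close> those of the remaining arguments. Together they are the correction
  terms over the whole list \<open>xs @ ys\<close>, which is the formula for
  \<open>D\<close>.\<close>

lemma nabla_pow_eq:
  assumes u: "u \<in> T q"
  shows "nabla_pow M nab s u = (D ^^ s) u"
proof -
  have along: "nabla_along M nab xs u ys = (D ^^ length xs) u (xs @ ys)"
    if "set xs \<subseteq> V" "set ys \<subseteq> V" for xs ys
    using that
  \<comment> \<open>The correction terms alter the directions, so the hypothesis has to cover all
    lists of one length.\<close>
  proof (induction "length xs" arbitrary: xs ys)
    case (Suc n)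
    then obtain X xs' where xs: "xs = X # xs'" "length xs' = n" by (cases xs) auto
    let ?w = "(D ^^ n) u"
    have IH: "nabla_along M nab xs'' u ys' = ?w (xs'' @ ys')"
      if "length xs'' = n" "set xs'' \<subseteq> V" "set ys' \<subseteq> V" for xs'' ys'
      using Suc.hyps(1)[of xs'' ys'] that by simp
    have X: "X \<in> V" "set xs' \<subseteq> V" using Suc.prems xs by auto
    have "nabla_along M nab xs u ys = tensor_nabla M nab X (nabla_along M nab xs' u) ys
        - deriv_args (nab X) (\<lambda>xs'. nabla_along M nab xs' u) xs' ys"
      by (simp add: xs deriv_args_def minus_apply)
    also have "deriv_args (nab X) (\<lambda>xs'. nabla_along M nab xs' u) xs' ys
        = deriv_args (nab X) (\<lambda>xs'. nabla_along M nab xs' u ys) xs'"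
    proof -
      have "(\<Sum>i\<in>I. F i) ys = (\<Sum>i\<in>I. F i ys)" for I :: "nat set" and F :: "nat \<Rightarrow> 'a tensor"
        using sum_comp_morphism[of "\<lambda>u. u ys" F I] by (simp add: plus_fun_apply zero_fun_apply comp_def)
      then show ?thesis by (simp add: deriv_args_def)
    qed
    also have "\<dots> = deriv_args (nab X) (\<lambda>xs'. ?w (xs' @ ys)) xs'"
      by (rule deriv_args_nab_cong) (use X xs Suc.prems IH in auto)
    also have "tensor_nabla M nab X (nabla_along M nab xs' u) ys
        = nab X (?w (xs' @ ys)) - deriv_args (nab X) (\<lambda>ys. ?w (xs' @ ys)) ys"
    proof -
      have "deriv_args (nab X) (nabla_along M nab xs' u) ys
          = deriv_args (nab X) (\<lambda>ys. ?w (xs' @ ys)) ys"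
        by (rule deriv_args_nab_cong) (use X xs Suc.prems IH in auto)
      then show ?thesis
        using Suc.prems IH[OF xs(2) X(2)] by (simp add: tensor_nabla_def deriv_args_def)
    qed
    finally show ?case
      using X Suc.prems by (simp add: xs D_Cons deriv_args_append algebra_simps)
  qed simp
  show ?thesis
  proof
    fix zs
    show "nabla_pow M nab s u zs = (D ^^ s) u zs"
    proof (cases "s \<le> length zs \<and> set zs \<subseteq> V")
      case True
      then have "set (take s zs) \<subseteq> V" "set (drop s zs) \<subseteq> V"
        using set_take_subset set_drop_subset by fastforce+
      then have "nabla_along M nab (take s zs) u (drop s zs) = (D ^^ s) u (take s zs @ drop s zs)"
        using True along[of "take s zs" "drop s zs"] by simp
      then show ?thesis
        using True by (simp add: nabla_pow_def)
    next
      case False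
      then show ?thesis
        using tensor_zero[OF D_pow_closed[OF u, of s], of zs] by (auto simp: nabla_pow_def)
    qed
  qed
qed

section \<open>Leibniz rule for permuted tensors and for insertions\<close>

lemma D_permute:
  assumes w: "w \<in> T q" and \<pi>: "\<pi> permutes {..<q}"
  shows "D (\<lambda>zs. w (permute_list \<pi> zs)) = (\<lambda>zs. D w (permute_list (lift_perm \<pi>) zs))"
proof (rule tensor_eqI)
  show "D (\<lambda>zs. w (permute_list \<pi> zs)) \<in> T (Suc q)"
    "(\<lambda>zs. D w (permute_list (lift_perm \<pi>) zs)) \<in> T (Suc q)"
    using assms by (simp_all add: D_closed tensor_permute_closed lift_perm_permutes)
  fix zs assume zs: "length zs = Suc q" "set zs \<subseteq> V"
  then obtain X ys where X: "zs = X # ys" "length ys = q" by (cases zs) auto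
  then have "set (permute_list \<pi> ys) \<subseteq> V"
    using \<pi> zs by simp
  then show "D (\<lambda>zs. w (permute_list \<pi> zs)) zs = D w (permute_list (lift_perm \<pi>) zs)"
    using X zs \<pi> by (simp add: D_Cons permute_list_lift_perm deriv_args_permute)
qed

text \<open>The corrections fall on arguments of \<open>u\<close> or on arguments of
  \<open>v\<close>. The term \<open>u (as @ nab X (v bs) # cs)\<close> occurs with a minus sign in
  the part with \<open>D u\<close> and with a plus sign in the part with \<open>D v\<close>; it
  cancels, and what remains is the derivative of the insertion.\<close>

lemma D_insert_id:
  assumes u: "u \<in> T m" and v: "v \<in> T n" and "i < m"
  shows "D (insert_tensor M m n i id u v)
    = insert_tensor M (Suc m) n (Suc i) id (D u) v
      + (\<lambda>zs. insert_tensor M m (Suc n) i id u (D v) (permute_list (front_cycle i) zs))"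
    (is "D ?I = ?A + (\<lambda>zs. ?B (permute_list ?\<rho> zs))")
proof (rule tensor_eqI)
  have I: "?I \<in> T (m - 1 + n)"
    by (rule insert_id_closed[OF assms])
  then show "D ?I \<in> T (Suc (m - 1 + n))"
    by (rule D_closed)
  \<comment> \<open>From \<open>i < m\<close> follows \<open>m \<ge> 1\<close>, so the truncated
    \<open>m - 1\<close> does no harm.\<close>
  have rank: "Suc m - 1 + n = Suc (m - 1 + n)" "m - 1 + Suc n = Suc (m - 1 + n)"
    using assms(3) by auto
  have A: "?A \<in> T (Suc (m - 1 + n))"
    using insert_id_closed[OF D_closed[OF u] v, of "Suc i"] assms(3) unfolding rank by blast
  have B: "?B \<in> T (Suc (m - 1 + n))"
    using insert_id_closed[OF u D_closed[OF v] assms(3)] unfolding rank .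
  have \<rho>: "?\<rho> permutes {..<Suc (m - 1 + n)}"
    using assms(3) by (intro front_cycle_permutes) simp
  show "?A + (\<lambda>zs. ?B (permute_list ?\<rho> zs)) \<in> T (Suc (m - 1 + n))"
    by (intro tensor_plus_closed A tensor_permute_closed B \<rho>)
  fix zs assume zs: "length zs = Suc (m - 1 + n)" "set zs \<subseteq> V"
  then obtain X ws where X: "zs = X # ws" "X \<in> V" by (cases zs) auto
  define as bs cs where "as = take i ws" and "bs = take n (drop i ws)" and "cs = drop (i + n) ws"
  have ws: "ws = as @ bs @ cs"
    unfolding as_def bs_def cs_def by (metis append_take_drop_id drop_drop add.commute)
  have len: "length as = i" "length bs = n" "length cs = m - 1 - i"
    using zs X assms(3) by (auto simp: as_def bs_def cs_def)
  have V: "set as \<subseteq> V" "set bs \<subseteq> V" "set cs \<subseteq> V"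
    using zs X ws by auto
  let ?d = "nab X"
  have Ieq: "?I (as' @ bs' @ cs') = u (as' @ v bs' # cs')"
    if "length as' = i" "length bs' = n" "length cs' = m - 1 - i"
      "set as' \<subseteq> V" "set bs' \<subseteq> V" "set cs' \<subseteq> V" for as' bs' cs'
    unfolding insert_tensor_id using that assms(3) by (simp add: insert_at_append)
  have "D ?I zs = ?d (?I ws) - deriv_args ?d ?I ws"
    using X zs by (simp add: D_Cons)
  also have "deriv_args ?d ?I ws = deriv_args ?d (\<lambda>xs. ?I (xs @ bs @ cs)) as
      + (deriv_args ?d (\<lambda>xs. ?I (as @ xs @ cs)) bs + deriv_args ?d (\<lambda>xs. ?I (as @ bs @ xs)) cs)"
    by (simp only: ws deriv_args_append)
  also have "deriv_args ?d (\<lambda>xs. ?I (xs @ bs @ cs)) as = deriv_args ?d (\<lambda>xs. u (xs @ v bs # cs)) as"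
    by (rule deriv_args_nab_cong) (use X V len Ieq in auto)
  also have "deriv_args ?d (\<lambda>xs. ?I (as @ xs @ cs)) bs = deriv_args ?d (\<lambda>xs. u (as @ v xs # cs)) bs"
    by (rule deriv_args_nab_cong) (use X V len Ieq in auto)
  also have "deriv_args ?d (\<lambda>xs. ?I (as @ bs @ xs)) cs = deriv_args ?d (\<lambda>xs. u (as @ v bs # xs)) cs"
    by (rule deriv_args_nab_cong) (use X V len Ieq in auto)
  also have "?I ws = u (as @ v bs # cs)"
    using Ieq len V ws by simp
  finally have lhs: "D ?I zs = ?d (u (as @ v bs # cs))
      - (deriv_args ?d (\<lambda>xs. u (xs @ v bs # cs)) as
        + (deriv_args ?d (\<lambda>xs. u (as @ v xs # cs)) bs
          + deriv_args ?d (\<lambda>xs. u (as @ v bs # xs)) cs))" .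
  have "?A zs = D u (X # as @ v bs # cs)"
    using zs X assms(3) insert_at_append[of "Suc i" "X # as" n bs "D u" v cs] len
    unfolding insert_tensor_id by (simp add: ws)
  also have "\<dots> = ?d (u (as @ v bs # cs)) - (deriv_args ?d (\<lambda>xs. u (xs @ v bs # cs)) as
      + (u (as @ ?d (v bs) # cs) + deriv_args ?d (\<lambda>xs. u (as @ v bs # xs)) cs))"
    using X V by (simp add: D_Cons tensor_closed[OF v] deriv_args_append deriv_args_Cons)
  finally have A_zs: "?A zs = \<dots>" .
  have "?B (permute_list ?\<rho> zs) = ?B (as @ (X # bs) @ cs)"
    using permute_list_front_cycle[of as X "bs @ cs"] X ws len by simp
  also have "\<dots> = u (as @ D v (X # bs) # cs)"
    using insert_at_append[of i as "Suc n" "X # bs" u "D v" cs] zs X V len assms(3)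
    unfolding insert_tensor_id by simp
  also have "\<dots> = u (as @ ?d (v bs) # cs) - u (as @ deriv_args ?d v bs # cs)"
    using X V by (simp add: D_Cons tensor_diff[OF u] nab_closed tensor_closed[OF v]
        deriv_args_closed[OF v])
  also have "u (as @ deriv_args ?d v bs # cs) = deriv_args ?d (\<lambda>xs. u (as @ v xs # cs)) bs"
    unfolding deriv_args_def by (intro tensor_sum[OF u] V tensor_closed[OF v])
  finally have B_zs: "?B (permute_list ?\<rho> zs)
      = u (as @ ?d (v bs) # cs) - deriv_args ?d (\<lambda>xs. u (as @ v xs # cs)) bs" .
  show "D ?I zs = (?A + (\<lambda>zs. ?B (permute_list ?\<rho> zs))) zs"
    unfolding plus_fun_apply[of ?A] lhs A_zs B_zs by (simp add: algebra_simps)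
qed

text \<open>Permuted insertions are stable under \<open>D\<close>. In the second term the old
  arguments are brought into the order \<open>\<pi>\<close> and the direction is then moved into the
  block of \<open>v\<close>.\<close>

lemma D_insert:
  assumes u: "u \<in> T m" and v: "v \<in> T n" and i: "i < m" and \<pi>: "\<pi> permutes {..<m - 1 + n}"
  shows "D (insert_tensor M m n i \<pi> u v)
    = insert_tensor M (Suc m) n (Suc i) (lift_perm \<pi>) (D u) v
      + insert_tensor M m (Suc n) i (lift_perm \<pi> \<circ> front_cycle i) u (D v)"
proof -
  have l: "lift_perm \<pi> permutes {..<Suc m - 1 + n}"
    using lift_perm_permutes[OF \<pi>] i by (simp add: Suc_diff_1)
  have f: "front_cycle i permutes {..<Suc m - 1 + n}"
    using i by (intro front_cycle_permutes) simp
  have lf: "lift_perm \<pi> \<circ> front_cycle i permutes {..<m - 1 + Suc n}"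
    using permutes_compose[OF f l] i by (simp add: Suc_diff_1)
  let ?B = "insert_tensor M m (Suc n) i id u (D v)"
  \<comment> \<open>Permutations compose on lists of the matching length; on all others the guard of
    the insertion gives 0.\<close>
  have "?B (permute_list (front_cycle i) (permute_list (lift_perm \<pi>) zs))
      = ?B (permute_list (lift_perm \<pi> \<circ> front_cycle i) zs)" for zs
  proof (cases "length zs = m + n")
    case True
    then show ?thesis using l f by (simp add: permute_list_compose)
  next
    case False
    then show ?thesis unfolding insert_tensor_id using i by simp
  qed
  note B = this
  let ?A = "insert_tensor M (Suc m) n (Suc i) id (D u) v"
  have "D (insert_tensor M m n i \<pi> u v)
      = (\<lambda>zs. D (insert_tensor M m n i id u v) (permute_list (lift_perm \<pi>) zs))"
    unfolding insert_tensor_permute[OF \<pi>] by (rule D_permute[OF insert_id_closed[OF u v i] \<pi>])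
  also have "\<dots> = (\<lambda>zs. ?A (permute_list (lift_perm \<pi>) zs)
      + ?B (permute_list (lift_perm \<pi> \<circ> front_cycle i) zs))"
    unfolding D_insert_id[OF u v i] plus_fun_apply[of ?A] B by (rule refl)
  also have "\<dots> = (\<lambda>zs. insert_tensor M (Suc m) n (Suc i) (lift_perm \<pi>) (D u) v zs
      + insert_tensor M m (Suc n) i (lift_perm \<pi> \<circ> front_cycle i) u (D v) zs)"
    unfolding insert_tensor_permute[OF l] insert_tensor_permute[OF lf] by (rule refl)
  also have "\<dots> = insert_tensor M (Suc m) n (Suc i) (lift_perm \<pi>) (D u) v
      + insert_tensor M m (Suc n) i (lift_perm \<pi> \<circ> front_cycle i) u (D v)"
    by (rule plus_fun_def[symmetric])
  finally show ?thesis .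
qed

end


section \<open>Sums with binomial coefficients\<close>

text \<open>Pascal's rule in the shape in which a Leibniz sum takes up one more derivative: it falls
  on the first factor, leaving \<open>a\<close>, or on the second, raising \<open>a\<close> by
  one.\<close>

lemma sum_choose_Suc:
  fixes F :: "nat \<Rightarrow> 'a::comm_semiring_1"
  shows "(\<Sum>a\<le>Suc s. of_nat (Suc s choose a) * F a)
    = (\<Sum>a\<le>s. of_nat (s choose a) * F a) + (\<Sum>a\<le>s. of_nat (s choose a) * F (Suc a))"
proof -
  have "(\<Sum>a\<le>s. of_nat (s choose a) * F a) = (\<Sum>a\<le>Suc s. of_nat (s choose a) * F a)"
    by (simp add: binomial_eq_0)
  also have "\<dots> = F 0 + (\<Sum>a\<le>s. of_nat (s choose Suc a) * F (Suc a))"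
    by (simp add: sum.atMost_Suc_shift del: sum.atMost_Suc)
  finally show ?thesis
    by (simp add: sum.atMost_Suc_shift algebra_simps sum.distrib del: sum.atMost_Suc)
qed

text \<open>Vandermonde's identity summed against \<open>G\<close>: to choose among
  \<open>h + d\<close> derivatives is to choose \<open>i\<close> of the first \<open>h\<close> and
  \<open>p\<close> of the other \<open>d\<close>.\<close>

lemma sum_choose_add:
  fixes G :: "nat \<Rightarrow> 'a::comm_semiring_1"
  shows "(\<Sum>a\<le>h + d. of_nat (h + d choose a) * G a)
    = (\<Sum>i\<le>h. of_nat (h choose i) * (\<Sum>p\<le>d. of_nat (d choose p) * G (i + p)))"
proof (induction h arbitrary: G)
  case (Suc h)
  show ?case
    using sum_choose_Suc[of "h + d" G] Suc.IH[of G] Suc.IH[of "\<lambda>a. G (Suc a)"]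
    by (simp only: add_Suc sum_choose_Suc[of h "\<lambda>i. \<Sum>p\<le>d. of_nat (d choose p) * G (i + p)"])
qed simp

lemma binom_of_nat: "binom (int d) (int p) = d choose p"
  by (simp add: binom_def binomial_eq_0)

text \<open>An index shift in the second term. Its binomial vanishes at \<open>p = 0\<close> and
  that of the first term at \<open>p = Suc d\<close>, so a single range serves both.\<close>

lemma sum_choose_Dyck_coeff:
  fixes X :: "nat \<Rightarrow> 'a::comm_semiring_1"
  shows "(\<Sum>p\<le>d. of_nat (d choose p) * (X p + 2 * X (Suc p)))
    = (\<Sum>p\<le>Suc d. of_nat (2 * binom (int d) (int p - 1) + binom (int d) (int p)) * X p)"
proof -
  have "(\<Sum>p\<le>Suc d. of_nat (2 * binom (int d) (int p - 1)) * X p)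
      = (\<Sum>p\<le>d. of_nat (d choose p) * (2 * X (Suc p)))"
    by (simp add: sum.atMost_Suc_shift binom_of_nat binom_def[of _ "- 1"] mult_ac
        del: sum.atMost_Suc)
  moreover have "(\<Sum>p\<le>Suc d. of_nat (binom (int d) (int p)) * X p) = (\<Sum>p\<le>d. of_nat (d choose p) * X p)"
    unfolding binom_of_nat by (simp add: binomial_eq_0)
  ultimately show ?thesis
    by (simp only: of_nat_add distrib_right distrib_left sum.distrib add.commute)
qed


section \<open>Dyck paths\<close>

lemma Dyck_D_cong: "(\<And>i. i \<in> {1..j} \<Longrightarrow> P i = Q i) \<Longrightarrow> Dyck_D P j = Dyck_D Q j"
  unfolding Dyck_D_def by (intro arg_cong2[of _ _ _ _ "(-)"] sum.cong) auto

lemma Dyck_D_upd: "Dyck_D (P(Suc j := p)) (Suc j) = Dyck_D P j + 1 - int p"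
  using Dyck_D_cong[of j "P(Suc j := p)" P] by (simp add: Dyck_D_def)

lemma Dyck_sum_le: "P \<in> Dyck k \<Longrightarrow> j \<le> k \<Longrightarrow> (\<Sum>r = 1..j. P r) \<le> j"
  by (cases "j = 0") (auto simp: Dyck_def)

lemma Dyck_D_nonneg: "P \<in> Dyck k \<Longrightarrow> j \<le> k \<Longrightarrow> Dyck_D P j \<ge> 0"
  using Dyck_sum_le[of P k j] unfolding Dyck_D_def of_nat_sum[symmetric] by linarith

lemma Dyck_C_upd:
  "Dyck_C (Suc j) (P(Suc j := p))
    = Dyck_C j P * (2 * binom (Dyck_D P j) (int p - 1) + binom (Dyck_D P j) (int p))"
proof -
  have "Dyck_D (P(Suc j := p)) i = Dyck_D P i" if "i \<le> j" for i
    using that by (intro Dyck_D_cong) auto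
  then show ?thesis
    by (auto simp: Dyck_C_def intro!: prod.cong arg_cong2[of _ _ _ _ "(*)"])
qed

lemma Dyck_D_Suc: "Dyck_D P (Suc j) = Dyck_D P j + 1 - int (P (Suc j))"
  by (simp add: Dyck_D_def)

text \<open>Families are extensional, so shortening a path resets its last entry to
  \<open>undefined\<close>. The one new constraint is that \<open>Dyck_D\<close> at
  \<open>Suc j\<close> be nonnegative.\<close>

lemma Dyck_Suc_iff:
  "P(Suc j := p) \<in> Dyck (Suc j) \<longleftrightarrow> P(Suc j := undefined) \<in> Dyck j \<and> int p \<le> Dyck_D P j + 1"
proof -
  have "(\<Sum>r = 1..i. (P(Suc j := q)) r) = (\<Sum>r = 1..i. P r)" if "i \<le> j" for i q
    using that by (intro sum.cong) auto
  moreover have "{1..Suc j} = insert (Suc j) {1..j}" by auto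
  ultimately show ?thesis
    by (auto simp: Dyck_def Dyck_D_def PiE_iff extensional_def simp flip: of_nat_sum)
qed

lemma finite_Dyck: "finite (Dyck k)"
proof (rule finite_subset)
  show "Dyck k \<subseteq> {1..k} \<rightarrow>\<^sub>E {..k}"
  proof (intro subsetI PiE_I)
    fix P i assume P: "P \<in> Dyck k" and i: "i \<in> {1..k}"
    have "P i \<le> (\<Sum>r = 1..i. P r)"
      using i by (intro member_le_sum) auto
    then show "P i \<in> {..k}" using Dyck_sum_le[OF P, of i] i by simp
  qed (auto simp: Dyck_def)
qed (simp add: finite_PiE)

lemma finite_compositions: "finite (compositions l h)"
proof (rule finite_subset)
  show "compositions l h \<subseteq> {1..l} \<rightarrow>\<^sub>E {..h}"
  proof (intro subsetI PiE_I)
    fix H i assume H: "H \<in> compositions l h" and i: "i \<in> {1..l}"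
    have "H i \<le> (\<Sum>r = 1..l. H r)"
      using i by (intro member_le_sum) auto
    then show "H i \<in> {..h}" using H by (simp add: compositions_def)
  qed (auto simp: compositions_def)
qed (simp add: finite_PiE)

text \<open>A path is built by appending entries, as the estimate expands one Lie derivative at a
  time. Since \<open>Dyck_D P j\<close> is nonnegative on \<open>Dyck j\<close>, \<open>nat\<close>
  loses nothing in the range of the last entry.\<close>

lemma sum_Dyck_Suc:
  "(\<Sum>P\<in>Dyck (Suc j). F P) = (\<Sum>P\<in>Dyck j. \<Sum>p\<le>nat (Dyck_D P j) + 1. F (P(Suc j := p)))"
proof -
  have "(\<Sum>P\<in>Dyck (Suc j). F P)
      = (\<Sum>(P, p)\<in>(SIGMA P:Dyck j. {..nat (Dyck_D P j) + 1}). F (P(Suc j := p)))"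
  proof (rule sum.reindex_bij_witness[of _ "\<lambda>(P, p). P(Suc j := p)"
        "\<lambda>P. (P(Suc j := undefined), P (Suc j))"])
    fix P assume P: "P \<in> Dyck (Suc j)"
    have "Dyck_D (P(Suc j := undefined)) j = Dyck_D P j" by (rule Dyck_D_cong) auto
    then show "(P(Suc j := undefined), P (Suc j)) \<in> (SIGMA P:Dyck j. {..nat (Dyck_D P j) + 1})"
      using P Dyck_Suc_iff[of P j "P (Suc j)"] by auto
  next
    fix b assume b: "b \<in> (SIGMA P:Dyck j. {..nat (Dyck_D P j) + 1})"
    then obtain P p where Pp: "b = (P, p)" "P \<in> Dyck j" "p \<le> nat (Dyck_D P j) + 1" by auto
    then have "P(Suc j := undefined) = P"
      by (auto simp: Dyck_def PiE_iff extensional_def)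
    moreover have "int p \<le> Dyck_D P j + 1"
      using Pp Dyck_D_nonneg[of P j j] by linarith
    ultimately show "(case b of (P, p) \<Rightarrow> P(Suc j := p)) \<in> Dyck (Suc j)"
      "(((case b of (P, p) \<Rightarrow> P(Suc j := p)))(Suc j := undefined),
        (case b of (P, p) \<Rightarrow> P(Suc j := p)) (Suc j)) = b"
      using Pp Dyck_Suc_iff[of P j p] by auto
  qed auto
  then show ?thesis
    by (simp add: sum.Sigma finite_Dyck del: sum.atMost_Suc)
qed

text \<open>The last part counts the derivatives still resting on the unexpanded tensor. Expanding
  one more Lie derivative gives \<open>i\<close> of them to the vector field and
  \<open>H l - i\<close> to the rest.\<close>

lemma sum_compositions_Suc:
  "(\<Sum>H\<in>compositions (Suc l) h. F H)
    = (\<Sum>H\<in>compositions l h. \<Sum>i\<le>H l. F (H(l := i, Suc l := H l - i)))" if "l \<ge> 1"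
proof -
  have split: "(\<Sum>r = 1..l. G r) = (\<Sum>r\<in>{1..<l}. G r) + G l" for G :: "nat \<Rightarrow> nat"
    using that by (simp add: sum.last_plus add.commute)
  have "(\<Sum>H\<in>compositions (Suc l) h. F H)
      = (\<Sum>(H, i)\<in>(SIGMA H:compositions l h. {..H l}). F (H(l := i, Suc l := H l - i)))"
  proof (rule sum.reindex_bij_witness[of _ "\<lambda>(H, i). H(l := i, Suc l := H l - i)"
        "\<lambda>H. (H(l := H l + H (Suc l), Suc l := undefined), H l)"])
    fix H assume H: "H \<in> compositions (Suc l) h"
    have "(\<Sum>r = 1..l. (H(l := H l + H (Suc l), Suc l := undefined)) r) = (\<Sum>r = 1..Suc l. H r)"
      unfolding sum.cl_ivl_Suc split by (auto intro!: sum.cong)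
    then show "(H(l := H l + H (Suc l), Suc l := undefined), H l)
        \<in> (SIGMA H:compositions l h. {..H l})"
      using H that by (auto simp: compositions_def PiE_iff extensional_def)
    show "(case (H(l := H l + H (Suc l), Suc l := undefined), H l) of
        (H, i) \<Rightarrow> H(l := i, Suc l := H l - i)) = H"
      by (auto simp: fun_eq_iff)
    then show "(case (H(l := H l + H (Suc l), Suc l := undefined), H l) of
        (H, i) \<Rightarrow> F (H(l := i, Suc l := H l - i))) = F H"
      by simp
  next
    fix b assume b: "b \<in> (SIGMA H:compositions l h. {..H l})"
    then obtain H i where Hi: "b = (H, i)" "H \<in> compositions l h" "i \<le> H l" by auto
    have "(\<Sum>r = 1..Suc l. (H(l := i, Suc l := H l - i)) r) = (\<Sum>r = 1..l. H r)"
      unfolding sum.cl_ivl_Suc split using Hi(3) by (auto intro!: sum.cong)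
    then show "(case b of (H, i) \<Rightarrow> H(l := i, Suc l := H l - i)) \<in> compositions (Suc l) h"
      using Hi that by (auto simp: compositions_def PiE_iff extensional_def)
    have "H (Suc l) = undefined"
      using Hi(2) by (auto simp: compositions_def PiE_iff extensional_def)
    then show "(((case b of (H, i) \<Rightarrow> H(l := i, Suc l := H l - i)))
        (l := (case b of (H, i) \<Rightarrow> H(l := i, Suc l := H l - i)) l
          + (case b of (H, i) \<Rightarrow> H(l := i, Suc l := H l - i)) (Suc l), Suc l := undefined),
        (case b of (H, i) \<Rightarrow> H(l := i, Suc l := H l - i)) l) = b"
      using Hi by (auto simp: fun_eq_iff)
  qed
  then show ?thesis
    by (simp add: sum.Sigma finite_compositions)
qed

text \<open>A factor with \<open>P j = 0\<close> is 1. Otherwise absorption turns the second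
  binomial into a multiple of the first, with ratio \<open>Dyck_D P j / P j\<close>.\<close>

lemma Dyck_C_eq:
  assumes "P \<in> Dyck k"
  shows "real (Dyck_C k P) = (\<Prod>j \<in> {j \<in> {1..k}. P j \<noteq> 0}.
    (2 + of_int (Dyck_D P j) / real (P j)) * real (binom (Dyck_D P (j - 1)) (int (P j) - 1)))"
proof -
  let ?c = "\<lambda>j. 2 * binom (Dyck_D P (j - 1)) (int (P j) - 1) + binom (Dyck_D P (j - 1)) (int (P j))"
  have one: "?c j = 1" if "j \<in> {1..k}" "P j = 0" for j
  proof -
    have "j - 1 \<le> k" using that by auto
    then show ?thesis
      using that Dyck_D_nonneg[OF assms, of "j - 1"] by (simp add: binom_def)
  qed
  have factor: "real (?c j)
      = (2 + of_int (Dyck_D P j) / real (P j)) * real (binom (Dyck_D P (j - 1)) (int (P j) - 1))"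
    if j: "j \<in> {1..k}" "P j \<noteq> 0" for j
  proof -
    obtain i where i: "j = Suc i" using j by (cases j) auto
    obtain p where p: "P j = Suc p" using j by (cases "P j") auto
    define d where "d = nat (Dyck_D P i)"
    have d: "Dyck_D P i = int d"
      using Dyck_D_nonneg[OF assms, of i] i j by (simp add: d_def)
    have Dj: "Dyck_D P j = int d - int p"
      using Dyck_D_Suc[of P i] d i p by simp
    then have "p \<le> d"
      using Dyck_D_nonneg[OF assms, of j] j by simp
    \<comment> \<open>Here \<open>d - p\<close> is \<open>Dyck_D P j\<close>, because
      \<open>P j = Suc p\<close>.\<close>
    have "Suc p * (d choose Suc p) = (d - p) * (d choose p)"
      by (simp only: binomial_absorption binomial_absorb_comp)
    then have "real (Suc p) * real (d choose Suc p) = real (d - p) * real (d choose p)"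
      by (metis of_nat_mult)
    then have "real (d choose Suc p) = (real d - real p) / real (Suc p) * real (d choose p)"
      using \<open>p \<le> d\<close> by (simp add: field_simps of_nat_diff)
    moreover have "binom (int d) (int (Suc p)) = d choose Suc p"
      by (rule binom_of_nat)
    moreover have "binom (int d) (int (Suc p) - 1) = d choose p"
      using binom_of_nat[of d p] by simp
    ultimately show ?thesis
      using i p d Dj by (simp add: binom_of_nat distrib_right del: of_nat_Suc)
  qed
  have "real (Dyck_C k P) = (\<Prod>j = 1..k. real (?c j))"
    by (simp add: Dyck_C_def)
  also have "\<dots> = (\<Prod>j \<in> {j \<in> {1..k}. P j \<noteq> 0}. real (?c j))"
    using one by (intro prod.mono_neutral_right) auto
  also have "\<dots> = (\<Prod>j \<in> {j \<in> {1..k}. P j \<noteq> 0}.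
    (2 + of_int (Dyck_D P j) / real (P j)) * real (binom (Dyck_D P (j - 1)) (int (P j) - 1)))"
    using factor by (intro prod.cong) auto
  finally show ?thesis .
qed


section \<open>Lie derivatives in terms of covariant derivatives\<close>

context manifold_connection
begin

lemma lie_bracket_eq:
  "torsion_free M nab \<Longrightarrow> \<xi> \<in> V \<Longrightarrow> \<eta> \<in> V \<Longrightarrow> lie_bracket \<xi> \<eta> = nab \<xi> \<eta> - nab \<eta> \<xi>"
  unfolding torsion_free_def by metis

text \<open>Vanishing torsion rewrites both brackets. The terms with \<open>nab \<xi>\<close> form
  \<open>D B\<close> with \<xi> in its first slot; \<open>nab (B [\<eta>]) \<xi>\<close> and
  \<open>B [nab \<eta> \<xi>]\<close> are the two compositions with
  \<open>D (vector_tensor \<xi>)\<close>.\<close>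

lemma lie_derivative_eq:
  assumes tf: "torsion_free M nab" and \<xi>: "\<xi> \<in> V" and B: "B \<in> T 1"
  shows "lie_derivative M \<xi> B
    = insert_tensor M 2 0 0 id (D B) (vector_tensor \<xi>)
      + - insert_tensor M 1 1 0 id (D (vector_tensor \<xi>)) B
      + insert_tensor M 1 1 0 id B (D (vector_tensor \<xi>))"
    (is "_ = ?X + - ?Y + ?Z")
proof
  fix zs
  have pw: "(?X + - ?Y + ?Z) zs = ?X zs - ?Y zs + ?Z zs"
    unfolding plus_fun_apply[of "?X + - ?Y"] plus_fun_apply[of ?X] uminus_apply[of ?Y] by simp
  show "lie_derivative M \<xi> B zs = (?X + - ?Y + ?Z) zs"
  proof (cases "length zs = 1 \<and> set zs \<subseteq> V")
    case True
    then obtain \<eta> where zs: "zs = [\<eta>]" and \<eta>: "\<eta> \<in> V"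
      by (auto simp: length_Suc_conv)
    note Bc = tensor_closed[OF B]
    have br: "lie_bracket \<xi> \<eta> = nab \<xi> \<eta> - nab \<eta> \<xi>" "lie_bracket \<xi> (B [\<eta>]) = nab \<xi> (B [\<eta>]) - nab (B [\<eta>]) \<xi>"
      using lie_bracket_eq[OF tf \<xi>] \<eta> Bc by simp_all
    have "?X zs = D B [\<xi>, \<eta>]"
      unfolding insert_tensor_id using \<eta> \<xi> by (simp add: zs insert_at_def vector_tensor_def)
    then have X: "?X zs = nab \<xi> (B [\<eta>]) - B [nab \<xi> \<eta>]"
      using \<xi> \<eta> by (simp add: D_Cons deriv_args_Cons)
    have "?Y zs = D (vector_tensor \<xi>) [B [\<eta>]]"
      unfolding insert_tensor_id using \<eta> by (simp add: zs insert_at_def)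
    then have Y: "?Y zs = nab (B [\<eta>]) \<xi>"
      using \<xi> \<eta> Bc by (simp add: D_Cons vector_tensor_def)
    have "?Z zs = B [D (vector_tensor \<xi>) [\<eta>]]"
      unfolding insert_tensor_id using \<eta> by (simp add: zs insert_at_def)
    then have Z: "?Z zs = B [nab \<eta> \<xi>]"
      using \<xi> \<eta> by (simp add: D_Cons vector_tensor_def)
    have "B [nab \<xi> \<eta> - nab \<eta> \<xi>] = B [nab \<xi> \<eta>] - B [nab \<eta> \<xi>]"
      using tensor_diff[OF B, of "[]" "[]"] \<xi> \<eta> nab_closed by simp
    then show ?thesis
      using \<eta> br unfolding pw X Y Z by (simp add: lie_derivative_def zs)
  next
    case False
    have z: "B ys = 0" if "length ys = length zs" "length zs \<noteq> 1" for ys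
      using that by (intro tensor_zero[OF B]) auto
    have "lie_bracket \<xi> 0 = 0"
      using lie_bracket_eq[OF tf \<xi> vector_fields_zero] nab_add[of 0 0 \<xi>] \<xi> vector_fields_zero by simp
    then have "lie_derivative M \<xi> B zs = 0"
      using False z by (cases "set zs \<subseteq> V") (auto simp: lie_derivative_def)
    moreover have "?X zs = 0" "?Y zs = 0" "?Z zs = 0"
      unfolding insert_tensor_id using False by auto
    ultimately show ?thesis unfolding pw by simp
  qed
qed

lemma lie_derivative_closed:
  assumes "torsion_free M nab" and \<xi>: "\<xi> \<in> V" and B: "B \<in> T 1"
  shows "lie_derivative M \<xi> B \<in> T 1"
proof -
  note v = vector_tensor_closed[OF \<xi>]
  note Dv = D_closed[OF v]
  have "D B \<in> T 2" using D_closed[OF B] by (simp add: numeral_2_eq_2)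
  then show ?thesis
    unfolding lie_derivative_eq[OF assms]
    using insert_id_closed[OF _ v, of "D B" 2 0] insert_id_closed[OF Dv B, of 0]
      insert_id_closed[OF B Dv, of 0]
    by (intro tensor_plus_closed tensor_uminus_closed) auto
qed

lemma foldr_lie_derivative_closed:
  assumes "torsion_free M nab" "A \<in> T 1" "\<And>j. j \<in> set js \<Longrightarrow> \<xi> j \<in> V"
  shows "foldr (\<lambda>j. lie_derivative M (\<xi> j)) js A \<in> T 1"
  using assms(3) by (induction js) (use assms(1,2) in \<open>auto intro: lie_derivative_closed[simplified]\<close>)

end


section \<open>Algebra norms\<close>

text \<open>What the Sobolev norm and an abstract \<open>tensor_norm\<close> have in common and all
  that the estimate uses of them. The connection inside the Sobolev norm is therefore independent of
  \<open>nab\<close>.\<close>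

locale algebra_norm = manifold_connection M nab
  for M :: "('a::{t2_space, second_countable_topology}, 'n::finite) atlas"
    and nab :: "'a vfield \<Rightarrow> 'a vfield \<Rightarrow> 'a vfield" +
  fixes N :: "nat \<Rightarrow> 'a tensor \<Rightarrow> ennreal" and C :: real
  assumes N_add: "u \<in> T q \<Longrightarrow> v \<in> T q \<Longrightarrow> N q (u + v) \<le> N q u + N q v"
    and N_uminus: "u \<in> T q \<Longrightarrow> N q (- u) = N q u"
    and algebra: "algebra_constant M N C"
    and tf: "torsion_free M nab"
begin

text \<open>Each derivative replaces an insertion by two, one with \<open>D u\<close> and one with
  \<open>D v\<close>. The algebra inequality is used only at \<open>s = 0\<close>, so
  \<open>C\<close> appears to the first power for every \<open>s\<close>.\<close>

lemma N_D_pow_insert: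
  assumes "u \<in> T m" "v \<in> T n" "i < m" "\<pi> permutes {..<m - 1 + n}"
  shows "N (s + (m - 1 + n)) ((D ^^ s) (insert_tensor M m n i \<pi> u v))
    \<le> ennreal C * (\<Sum>a\<le>s. of_nat (s choose a)
        * (N (s - a + m) ((D ^^ (s - a)) u) * N (a + n) ((D ^^ a) v)))"
proof -
  \<comment> \<open>Without the constant \<open>Q\<close>, unification with the induction rule exceeds its bound.\<close>
  define Q where "Q s \<longleftrightarrow> (\<forall>m n i \<pi> u v.
    u \<in> T m \<longrightarrow> v \<in> T n \<longrightarrow> i < m \<longrightarrow> \<pi> permutes {..<m - 1 + n} \<longrightarrow>
    N (s + (m - 1 + n)) ((D ^^ s) (insert_tensor M m n i \<pi> u v))
    \<le> ennreal C * (\<Sum>a\<le>s. of_nat (s choose a)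
        * (N (s - a + m) ((D ^^ (s - a)) u) * N (a + n) ((D ^^ a) v))))" for s
  have "Q s"
  proof (induction s)
    case 0
    show ?case
      using algebra unfolding algebra_constant_def Q_def by (simp add: mult.assoc)
  next
    case (Suc s)
    show ?case
      unfolding Q_def
    proof (intro allI impI)
      fix m n i \<pi> u v
      assume u: "u \<in> T m" and v: "v \<in> T n" and i: "i < m" and \<pi>: "\<pi> permutes {..<m - 1 + n}"
      let ?I = "insert_tensor M (Suc m) n (Suc i) (lift_perm \<pi>) (D u) v"
      let ?J = "insert_tensor M m (Suc n) i (lift_perm \<pi> \<circ> front_cycle i) u (D v)"
      define F where "F a = N (Suc s - a + m) ((D ^^ (Suc s - a)) u) * N (a + n) ((D ^^ a) v)" for a
      have rank: "Suc m - 1 + n = Suc (m - 1 + n)" "m - 1 + Suc n = Suc (m - 1 + n)"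
        "s + Suc (m - 1 + n) = Suc s + (m - 1 + n)"
        using i by auto
      have perm: "lift_perm \<pi> permutes {..<Suc m - 1 + n}"
        "lift_perm \<pi> \<circ> front_cycle i permutes {..<m - 1 + Suc n}"
        unfolding rank using lift_perm_permutes[OF \<pi>] i
        by (auto intro!: permutes_compose front_cycle_permutes)
      have I: "?I \<in> T (Suc (m - 1 + n))" and J: "?J \<in> T (Suc (m - 1 + n))"
        using insert_tensor_closed[OF D_closed[OF u] v _ perm(1), of "Suc i"]
          insert_tensor_closed[OF u D_closed[OF v] i perm(2)] i unfolding rank by auto
      \<comment> \<open>The innermost derivative is split off, so that the hypothesis meets plain
        insertions again.\<close>
      have "(D ^^ Suc s) (insert_tensor M m n i \<pi> u v) = (D ^^ s) ?I + (D ^^ s) ?J"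
        using D_insert[OF u v i \<pi>] D_pow_add[OF I J, of s]
        by (simp only: funpow.simps(2) comp_apply[of D] funpow_swap1)
      then have "N (Suc s + (m - 1 + n)) ((D ^^ Suc s) (insert_tensor M m n i \<pi> u v))
          \<le> N (s + Suc (m - 1 + n)) ((D ^^ s) ?I) + N (s + Suc (m - 1 + n)) ((D ^^ s) ?J)"
        using N_add[OF D_pow_closed[OF I] D_pow_closed[OF J], of s] unfolding rank(3) by simp
      also have "N (s + Suc (m - 1 + n)) ((D ^^ s) ?I) \<le> ennreal C * (\<Sum>a\<le>s. of_nat (s choose a) * F a)"
      proof -
        have "N (s - a + Suc m) ((D ^^ (s - a)) (D u)) * N (a + n) ((D ^^ a) v) = F a" if "a \<le> s" for a
          using that by (simp add: F_def Suc_diff_le funpow_swap1)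
        then show ?thesis
          using Suc.IH[unfolded Q_def, rule_format, OF D_closed[OF u] v _ perm(1), of "Suc i"] i
          unfolding rank by simp
      qed
      also have "N (s + Suc (m - 1 + n)) ((D ^^ s) ?J) \<le> ennreal C * (\<Sum>a\<le>s. of_nat (s choose a) * F (Suc a))"
        using Suc.IH[unfolded Q_def, rule_format, OF u D_closed[OF v] i perm(2)]
        unfolding rank by (simp add: F_def funpow_swap1)
      finally show "N (Suc s + (m - 1 + n)) ((D ^^ Suc s) (insert_tensor M m n i \<pi> u v))
          \<le> ennreal C * (\<Sum>a\<le>Suc s. of_nat (Suc s choose a)
            * (N (Suc s - a + m) ((D ^^ (Suc s - a)) u) * N (a + n) ((D ^^ a) v)))"
        unfolding F_def[symmetric] sum_choose_Suc distrib_left by (simp add: add_mono)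
    qed
  qed
  then show ?thesis unfolding Q_def using assms by blast
qed

abbreviation "n\<^sub>V \<xi> a \<equiv> N a ((D ^^ a) (vector_tensor \<xi>))"
abbreviation "n\<^sub>E B a \<equiv> N (a + 1) ((D ^^ a) B)"

lemma N_D_pow_lie_derivative:
  assumes \<xi>: "\<xi> \<in> V" and B: "B \<in> T 1"
  shows "n\<^sub>E (lie_derivative M \<xi> B) m \<le> ennreal C * (\<Sum>a\<le>m. of_nat (m choose a)
      * (n\<^sub>V \<xi> a * n\<^sub>E B (Suc (m - a)) + 2 * (n\<^sub>V \<xi> (Suc a) * n\<^sub>E B (m - a))))"
proof -
  let ?v = "vector_tensor \<xi>"
  let ?X = "insert_tensor M 2 0 0 id (D B) ?v"
  let ?Y = "insert_tensor M 1 1 0 id (D ?v) B"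
  let ?Z = "insert_tensor M 1 1 0 id B (D ?v)"
  note v = vector_tensor_closed[OF \<xi>]
  note Dv = D_closed[OF v, unfolded One_nat_def[symmetric]]
  have DB: "D B \<in> T 2" using D_closed[OF B] by (simp add: numeral_2_eq_2)
  have T1: "?X \<in> T 1" "?Y \<in> T 1" "?Z \<in> T 1"
    using insert_id_closed[OF DB v, of 0] insert_id_closed[OF Dv B, of 0]
      insert_id_closed[OF B Dv, of 0] by auto
  note X = D_pow_closed[OF T1(1), of m] and Y = D_pow_closed[OF T1(2), of m]
    and Z = D_pow_closed[OF T1(3), of m]
  note Y' = tensor_uminus_closed[OF Y]
  have D_lie: "(D ^^ m) (lie_derivative M \<xi> B) = (D ^^ m) ?X + - (D ^^ m) ?Y + (D ^^ m) ?Z"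
    unfolding lie_derivative_eq[OF tf \<xi> B]
    by (simp only: D_pow_add[OF tensor_plus_closed T1(3)] D_pow_add[OF T1(1) tensor_uminus_closed]
        T1 tensor_uminus_closed D_pow_uminus[OF T1(2)])
  have split: "n\<^sub>E (lie_derivative M \<xi> B) m
      \<le> N (m + 1) ((D ^^ m) ?X) + N (m + 1) ((D ^^ m) ?Y) + N (m + 1) ((D ^^ m) ?Z)"
    using order_trans[OF N_add[OF tensor_plus_closed[OF X Y'] Z] add_right_mono[OF N_add[OF X Y']]]
    unfolding D_lie N_uminus[OF Y] .
  let ?S = "\<Sum>a\<le>m. of_nat (m choose a) * (n\<^sub>V \<xi> (Suc a) * n\<^sub>E B (m - a))"
  have bound_X: "N (m + 1) ((D ^^ m) ?X)
      \<le> ennreal C * (\<Sum>a\<le>m. of_nat (m choose a) * (n\<^sub>V \<xi> a * n\<^sub>E B (Suc (m - a))))"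
    using N_D_pow_insert[OF DB v, of 0 id m] by (simp add: permutes_id funpow_swap1 mult.commute)
  have "N (m + 1) ((D ^^ m) ?Y)
      \<le> ennreal C * (\<Sum>a\<le>m. of_nat (m choose a) * (n\<^sub>V \<xi> (Suc (m - a)) * n\<^sub>E B a))"
    using N_D_pow_insert[OF Dv B, of 0 id m] by (simp add: permutes_id funpow_swap1)
  \<comment> \<open>In \<open>?Y\<close> the field is the outer tensor and \<open>a\<close> counts
    the derivatives on \<open>B\<close>. Reversing the sum gives \<open>?Y\<close> the same bound as
    \<open>?Z\<close>, whence the factor 2.\<close>
  moreover have "(\<Sum>a\<le>m. of_nat (m choose a) * (n\<^sub>V \<xi> (Suc (m - a)) * n\<^sub>E B a)) = ?S"
    by (rule sum.reindex_bij_witness[of _ "\<lambda>a. m - a" "\<lambda>a. m - a"])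
      (auto simp: binomial_symmetric[symmetric])
  ultimately have bound_Y: "N (m + 1) ((D ^^ m) ?Y) \<le> ennreal C * ?S"
    by (simp only:)
  have bound_Z: "N (m + 1) ((D ^^ m) ?Z) \<le> ennreal C * ?S"
    using N_D_pow_insert[OF B Dv, of 0 id m] by (simp add: permutes_id funpow_swap1 mult.commute)
  show ?thesis
    using order_trans[OF split add_mono[OF add_mono[OF bound_X bound_Y] bound_Z]]
    by (simp only: distrib_left sum.distrib mult_2 add.assoc)
qed

text \<open>Only the \<open>h\<close> derivatives carry a factorial: \<open>1 / fact h\<close> times
  \<open>h choose i\<close> splits into the weights of the two factors. The \<open>d\<close>
  derivatives are inherited from Lie derivatives expanded before, and their binomials
  survive.\<close>

lemma N_lie_derivative_step:
  assumes \<xi>: "\<xi> \<in> V" and B: "B \<in> T 1"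
  shows "ennreal (1 / fact h) * n\<^sub>E (lie_derivative M \<xi> B) (h + d)
    \<le> ennreal C * (\<Sum>p\<le>Suc d. \<Sum>i\<le>h.
        of_nat (2 * binom (int d) (int p - 1) + binom (int d) (int p))
        * (ennreal (1 / fact i) * n\<^sub>V \<xi> (i + p))
        * (ennreal (1 / fact (h - i)) * n\<^sub>E B (h - i + (Suc d - p))))"
proof -
  define G where "G a = n\<^sub>V \<xi> a * n\<^sub>E B (Suc (h + d - a)) + 2 * (n\<^sub>V \<xi> (Suc a) * n\<^sub>E B (h + d - a))" for a
  define X where "X i p = n\<^sub>V \<xi> (i + p) * n\<^sub>E B (h - i + (Suc d - p))" for i p
  have G: "G (i + p) = X i p + 2 * X i (Suc p)" if "i \<le> h" "p \<le> d" for i p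
  proof -
    have "Suc (h + d - (i + p)) = h - i + (Suc d - p)" "h + d - (i + p) = h - i + (Suc d - Suc p)"
      using that by auto
    then show ?thesis by (simp only: G_def X_def add_Suc_right)
  qed
  have fact: "ennreal (1 / fact h) * of_nat (h choose i) = ennreal (1 / fact i) * ennreal (1 / fact (h - i))"
    if "i \<le> h" for i
    using that by (simp add: ennreal_of_nat_eq_real_of_nat binomial_fact flip: ennreal_mult)
  have "ennreal (1 / fact h) * n\<^sub>E (lie_derivative M \<xi> B) (h + d)
      \<le> ennreal (1 / fact h) * (ennreal C * (\<Sum>a\<le>h + d. of_nat (h + d choose a) * G a))"
    unfolding G_def by (intro mult_left_mono N_D_pow_lie_derivative \<xi> B) simp
  also have "\<dots> = ennreal C * (\<Sum>i\<le>h. ennreal (1 / fact h) * of_nat (h choose i)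
      * (\<Sum>p\<le>d. of_nat (d choose p) * G (i + p)))"
    unfolding sum_choose_add by (simp add: sum_distrib_left mult_ac)
  also have "(\<Sum>i\<le>h. ennreal (1 / fact h) * of_nat (h choose i)
      * (\<Sum>p\<le>d. of_nat (d choose p) * G (i + p)))
    = (\<Sum>i\<le>h. ennreal (1 / fact i) * ennreal (1 / fact (h - i))
      * (\<Sum>p\<le>Suc d. of_nat (2 * binom (int d) (int p - 1) + binom (int d) (int p)) * X i p))"
    unfolding sum_choose_Dyck_coeff[symmetric] by (intro sum.cong refl) (simp add: G fact)
  also have "\<dots> = (\<Sum>p\<le>Suc d. \<Sum>i\<le>h.
        of_nat (2 * binom (int d) (int p - 1) + binom (int d) (int p))
        * (ennreal (1 / fact i) * n\<^sub>V \<xi> (i + p))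
        * (ennreal (1 / fact (h - i)) * n\<^sub>E B (h - i + (Suc d - p))))"
    unfolding sum_distrib_left X_def by (subst sum.swap) (intro sum.cong refl, simp only: mult_ac)
  finally show ?thesis .
qed

theorem N_iterated_lie_derivative:
  assumes A: "A \<in> T 1" and \<xi>: "\<And>j. j \<in> {1..k} \<Longrightarrow> \<xi> j \<in> V"
  shows "ennreal (1 / fact h) * n\<^sub>E (foldr (\<lambda>j. lie_derivative M (\<xi> j)) [1..<k + 1] A) h
    \<le> ennreal (C ^ k) * (\<Sum>(P, H) \<in> Dyck k \<times> compositions (k + 1) h.
        of_nat (Dyck_C k P)
        * (ennreal (1 / fact (H (k + 1))) * n\<^sub>E A (H (k + 1) + nat (Dyck_D P k)))
        * (\<Prod>j = 1..k. ennreal (1 / fact (H j)) * n\<^sub>V (\<xi> j) (H j + P j)))"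
proof -
  \<comment> \<open>What is left after the first \<open>j\<close> Lie derivatives are expanded:
    \<open>B 0\<close> is the full product applied to \<open>A\<close>, and \<open>B k\<close> is
    \<open>A\<close>.\<close>
  define B where "B j = foldr (\<lambda>j. lie_derivative M (\<xi> j)) [Suc j..<Suc k] A" for j
  have B_Suc: "B j = lie_derivative M (\<xi> (Suc j)) (B (Suc j))" if "j < k" for j
    using that by (simp add: B_def upt_conv_Cons del: upt_Suc)
  have B_closed: "B j \<in> T 1" if "j \<le> k" for j
    unfolding B_def by (intro foldr_lie_derivative_closed tf A \<xi>) auto
  \<comment> \<open>The summand after \<open>j\<close> expansions, interpolating between the left
    side at \<open>j = 0\<close> and the claimed summand at \<open>j = k\<close>.\<close>
  define W where "W j P H = of_nat (Dyck_C j P)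
      * (ennreal (1 / fact (H (Suc j))) * n\<^sub>E (B j) (H (Suc j) + nat (Dyck_D P j)))
      * (\<Prod>i = 1..j. ennreal (1 / fact (H i)) * n\<^sub>V (\<xi> i) (H i + P i))" for j P H
  have C: "C > 0" using algebra by (simp add: algebra_constant_def)
  have step: "W j P H \<le> ennreal C * (\<Sum>p\<le>nat (Dyck_D P j) + 1. \<Sum>i\<le>H (Suc j).
      W (Suc j) (P(Suc j := p)) (H(Suc j := i, Suc (Suc j) := H (Suc j) - i)))"
    if j: "j < k" and P: "P \<in> Dyck j" for j P H
  proof -
    define d where "d = nat (Dyck_D P j)"
    have d: "Dyck_D P j = int d"
      using Dyck_D_nonneg[OF P] by (simp add: d_def)
    let ?h = "H (Suc j)" and ?c = "\<lambda>p. 2 * binom (int d) (int p - 1) + binom (int d) (int p)"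
    let ?\<Pi> = "\<Prod>i = 1..j. ennreal (1 / fact (H i)) * n\<^sub>V (\<xi> i) (H i + P i)"
    have W: "W (Suc j) (P(Suc j := p)) (H(Suc j := i, Suc (Suc j) := ?h - i))
        = (of_nat (Dyck_C j P) * ?\<Pi>) * (of_nat (?c p)
          * (ennreal (1 / fact i) * n\<^sub>V (\<xi> (Suc j)) (i + p))
          * (ennreal (1 / fact (?h - i)) * n\<^sub>E (B (Suc j)) (?h - i + (Suc d - p))))"
      if "p \<le> Suc d" for p i
    proof -
      have "nat (int d + 1 - int p) = Suc d - p" by simp
      moreover have "(\<Prod>l = 1..j. ennreal (1 / fact ((H(Suc j := i, Suc (Suc j) := ?h - i)) l))
          * n\<^sub>V (\<xi> l) ((H(Suc j := i, Suc (Suc j) := ?h - i)) l + (P(Suc j := p)) l)) = ?\<Pi>"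
        by (intro prod.cong) auto
      ultimately show ?thesis
        unfolding W_def Dyck_C_upd Dyck_D_upd d prod.cl_ivl_Suc by (simp add: mult_ac)
    qed
    have "W j P H = (of_nat (Dyck_C j P) * ?\<Pi>)
        * (ennreal (1 / fact ?h) * n\<^sub>E (lie_derivative M (\<xi> (Suc j)) (B (Suc j))) (?h + d))"
      unfolding W_def B_Suc[OF j] d_def by (simp only: mult_ac)
    also have "\<dots> \<le> (of_nat (Dyck_C j P) * ?\<Pi>) * (ennreal C * (\<Sum>p\<le>Suc d. \<Sum>i\<le>?h. of_nat (?c p)
          * (ennreal (1 / fact i) * n\<^sub>V (\<xi> (Suc j)) (i + p))
          * (ennreal (1 / fact (?h - i)) * n\<^sub>E (B (Suc j)) (?h - i + (Suc d - p)))))"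
      using j by (intro mult_left_mono N_lie_derivative_step \<xi> B_closed) auto
    also have "\<dots> = ennreal C * (\<Sum>p\<le>Suc d. \<Sum>i\<le>?h.
        W (Suc j) (P(Suc j := p)) (H(Suc j := i, Suc (Suc j) := ?h - i)))"
      unfolding mult.left_commute[of _ "ennreal C"] sum_distrib_left[of "of_nat (Dyck_C j P) * ?\<Pi>"]
      by (intro arg_cong2[of _ _ _ _ "(*)"] sum.cong refl) (use W in simp)
    finally show ?thesis by (simp only: d_def Suc_eq_plus1)
  qed
  have "ennreal (1 / fact h) * n\<^sub>E (B 0) h
      \<le> ennreal (C ^ j) * (\<Sum>P\<in>Dyck j. \<Sum>H\<in>compositions (Suc j) h. W j P H)" if "j \<le> k" for j
    using that
  proof (induction j)
    case 0
    \<comment> \<open>Both index sets are singletons, and the only summand is the left side.\<close>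
    have "Dyck 0 = {\<lambda>_. undefined}"
      by (auto simp: Dyck_def)
    moreover have "compositions (Suc 0) h = {\<lambda>i. if i = 1 then h else undefined}"
      by (auto simp: compositions_def PiE_iff extensional_def fun_eq_iff)
    ultimately show ?case
      by (simp add: W_def Dyck_C_def Dyck_D_def)
  next
    case (Suc j)
    have "ennreal (1 / fact h) * n\<^sub>E (B 0) h
        \<le> ennreal (C ^ j) * (\<Sum>P\<in>Dyck j. \<Sum>H\<in>compositions (Suc j) h. W j P H)"
      using Suc by simp
    also have "\<dots> \<le> ennreal (C ^ j) * (\<Sum>P\<in>Dyck j. \<Sum>H\<in>compositions (Suc j) h.
        ennreal C * (\<Sum>p\<le>nat (Dyck_D P j) + 1. \<Sum>i\<le>H (Suc j).
          W (Suc j) (P(Suc j := p)) (H(Suc j := i, Suc (Suc j) := H (Suc j) - i))))"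
      using Suc.prems by (intro mult_left_mono sum_mono step) auto
    \<comment> \<open>The range of \<open>p\<close> depends on \<open>P\<close> alone, so the sum
      over \<open>H\<close> moves inside it.\<close>
    also have "\<dots> = ennreal (C ^ j) * (ennreal C * (\<Sum>P\<in>Dyck j. \<Sum>p\<le>nat (Dyck_D P j) + 1.
        \<Sum>H\<in>compositions (Suc j) h. \<Sum>i\<le>H (Suc j).
          W (Suc j) (P(Suc j := p)) (H(Suc j := i, Suc (Suc j) := H (Suc j) - i))))"
      unfolding sum_distrib_left[symmetric] by (subst sum.swap) (rule refl)
    also have "\<dots> = ennreal (C ^ Suc j)
        * (\<Sum>P\<in>Dyck (Suc j). \<Sum>H\<in>compositions (Suc (Suc j)) h. W (Suc j) P H)"
      using C by (simp only: sum_Dyck_Suc sum_compositions_Suc ennreal_mult power_Suc2 mult.assoc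
          zero_le_power less_imp_le le_add1 plus_1_eq_Suc)
    finally show ?case .
  qed
  from this[of k] show ?thesis
    by (simp add: B_def W_def sum.cartesian_product del: upt_Suc)
qed

end


section \<open>Subadditivity of the Sobolev norm\<close>

locale riemannian_manifold = manifold M
  for M :: "('a::{t2_space, second_countable_topology}, 'n::finite) atlas" +
  fixes g :: "'a metric"
  assumes metric: "riemannian_metric M g"
begin

abbreviation "len p v \<equiv> sqrt (g p v v)"

context
  fixes p :: 'a
begin

abbreviation "T\<^sub>p \<equiv> tangent_space M p"

lemma g_sym: "v \<in> T\<^sub>p \<Longrightarrow> w \<in> T\<^sub>p \<Longrightarrow> g p v w = g p w v"
  using metric unfolding riemannian_metric_def by blast

lemma g_scale: "v \<in> T\<^sub>p \<Longrightarrow> w \<in> T\<^sub>p \<Longrightarrow> g p (\<lambda>f. c * v f) w = c * g p v w"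
  using metric unfolding riemannian_metric_def by blast

lemma g_add: "v \<in> T\<^sub>p \<Longrightarrow> v' \<in> T\<^sub>p \<Longrightarrow> w \<in> T\<^sub>p \<Longrightarrow> g p (v + v') w = g p v w + g p v' w"
  using metric unfolding riemannian_metric_def by blast

lemma g_scale2: "v \<in> T\<^sub>p \<Longrightarrow> g p (\<lambda>f. c * v f) (\<lambda>f. c * v f) = c\<^sup>2 * g p v v"
  using g_scale g_sym tangent_scale by (simp add: power2_eq_square)

lemma g_nonneg:
  assumes "v \<in> T\<^sub>p"
  shows "g p v v \<ge> 0"
proof (cases "v = 0")
  case True
  then have "(\<lambda>f. 0 * v f) = v" by (auto simp: zero_fun_def)
  then show ?thesis using g_scale[OF assms assms, of 0] by simp
next
  case False
  then show ?thesis
    using metric assms unfolding riemannian_metric_def by (metis less_imp_le)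
qed

lemma g_Cauchy_Schwarz:
  assumes v: "v \<in> T\<^sub>p" and w: "w \<in> T\<^sub>p"
  shows "g p v w \<le> len p v * len p w"
proof -
  have expand: "g p (v + (\<lambda>f. t * w f)) (v + (\<lambda>f. t * w f)) = g p v v + 2 * t * g p v w + t\<^sup>2 * g p w w"
    for t
  proof -
    note tw = tangent_scale[OF w, of t]
    have "g p (v + (\<lambda>f. t * w f)) (v + (\<lambda>f. t * w f))
        = g p v (v + (\<lambda>f. t * w f)) + t * g p w (v + (\<lambda>f. t * w f))"
      using v w tw tangent_add[OF v tw] by (simp add: g_add g_scale)
    also have "g p v (v + (\<lambda>f. t * w f)) = g p v v + t * g p v w"
      using g_sym[OF v tangent_add[OF v tw]] g_add[OF v tw v] g_scale[OF w v] g_sym[OF v w] by simp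
    also have "g p w (v + (\<lambda>f. t * w f)) = g p v w + t * g p w w"
      using g_sym[OF w tangent_add[OF v tw]] g_add[OF v tw w] g_scale[OF w w] by simp
    finally show ?thesis by (simp add: algebra_simps power2_eq_square)
  qed
  have nonneg: "0 \<le> g p v v + 2 * t * g p v w + t\<^sup>2 * g p w w" for t
    unfolding expand[symmetric] by (intro g_nonneg tangent_add v tangent_scale w)
  have "(g p v w)\<^sup>2 \<le> g p v v * g p w w"
  proof (cases "g p w w = 0")
    case True
    have "g p v w = 0"
    proof (rule ccontr)
      assume "g p v w \<noteq> 0"
      then show False
        \<comment> \<open>With \<open>g p w w = 0\<close> the polynomial in \<open>t\<close> is
          affine, and at this point its value is -1.\<close>
        using nonneg[of "- (g p v v + 1) / (2 * g p v w)"] True by (simp add: field_simps)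
    qed
    then show ?thesis using True by simp
  next
    case False
    then have pos: "g p w w > 0" using g_nonneg[OF w] by simp
    have "0 \<le> g p v v - (g p v w)\<^sup>2 / g p w w"
      using nonneg[of "- g p v w / g p w w"] False by (simp add: field_simps power2_eq_square)
    then show ?thesis using pos by (simp add: field_simps)
  qed
  then show ?thesis
    using real_le_rsqrt[of "g p v w" "g p v v * g p w w"] by (simp add: real_sqrt_mult)
qed

lemma len_triangle:
  assumes v: "v \<in> T\<^sub>p" and w: "w \<in> T\<^sub>p"
  shows "len p (v + w) \<le> len p v + len p w"
proof (rule real_le_lsqrt)
  have vw: "v + w \<in> T\<^sub>p" by (intro tangent_add v w)
  have "g p (v + w) (v + w) = g p v v + 2 * g p v w + g p w w"
    using g_add[OF v w vw] g_sym[OF v vw] g_sym[OF w vw] g_add[OF v w v] g_add[OF v w w] g_sym[OF v w]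
    by simp
  also have "\<dots> \<le> g p v v + 2 * (len p v * len p w) + g p w w"
    using g_Cauchy_Schwarz[OF v w] by simp
  also have "\<dots> = (len p v + len p w)\<^sup>2"
    using g_nonneg[OF v] g_nonneg[OF w] by (simp add: power2_sum)
  finally show "g p (v + w) (v + w) \<le> (len p v + len p w)\<^sup>2" .
qed (use g_nonneg assms in auto)

end

section \<open>The pointwise max norm: subadditivity and lower semicontinuity\<close>

lemma max_norm_add:
  assumes u: "u \<in> T q" and v: "v \<in> T q"
  shows "max_norm M g q (u + v) p \<le> max_norm M g q u p + max_norm M g q v p"
  unfolding max_norm_def
proof (rule SUP_least)
  let ?U = "{zs. length zs = q \<and> set zs \<subseteq> {\<xi> \<in> V. g p (\<xi> p) (\<xi> p) = 1}}"
  let ?F = "\<lambda>u zs. ennreal (len p (u zs p))"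
  fix zs assume zs: "zs \<in> ?U"
  have tan: "u zs p \<in> tangent_space M p" "v zs p \<in> tangent_space M p"
    using tensor_closed[OF u] tensor_closed[OF v] vector_fields_tangent by auto
  have "(u + v) zs p = u zs p + v zs p" by (simp add: plus_fun_def)
  then have "?F (u + v) zs \<le> ennreal (len p (u zs p) + len p (v zs p))"
    using len_triangle[OF tan] by (intro ennreal_leI) simp
  also have "\<dots> = ?F u zs + ?F v zs"
    using g_nonneg tan by (intro ennreal_plus) auto
  also have "\<dots> \<le> (SUP zs\<in>?U. ?F u zs) + (SUP zs\<in>?U. ?F v zs)"
    using zs by (intro add_mono SUP_upper)
  finally show "?F (u + v) zs \<le> (SUP zs\<in>?U. ?F u zs) + (SUP zs\<in>?U. ?F v zs)" .
qed

lemma max_norm_uminus: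
  assumes u: "u \<in> T q"
  shows "max_norm M g q (- u) p = max_norm M g q u p"
proof -
  have "len p ((- u) zs p) = len p (u zs p)" for zs
  proof -
    have "(- u) zs p = (\<lambda>f. (- 1) * u zs p f)" by (simp add: fun_Compl_def)
    then show ?thesis
      using g_scale2[of "u zs p" p "- 1"] tensor_closed[OF u, of zs] vector_fields_tangent by simp
  qed
  then show ?thesis by (simp add: max_norm_def)
qed

text \<open>For renormalizing a whole tuple of fields by constants. The prefix \<open>as\<close>
  collects the entries already scaled during the induction.\<close>

lemma tensor_map_scale:
  assumes u: "u \<in> T q" and "set as \<subseteq> V" "set zs \<subseteq> V"
  shows "u (as @ map (\<lambda>z. fmult (\<lambda>_. c z) z) zs)
    = fmult (\<lambda>_. \<Prod>z\<leftarrow>zs. c z) (u (as @ zs))"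
  using assms(2,3)
proof (induction zs arbitrary: as)
  case Nil
  then show ?case by (simp add: fmult_def)
next
  case (Cons z zs)
  have "fmult (\<lambda>_. c z) z \<in> V"
    using Cons.prems by (intro vector_fields_fmult smooth_const) simp
  then have "u (as @ map (\<lambda>z. fmult (\<lambda>_. c z) z) (z # zs))
      = fmult (\<lambda>_. \<Prod>z\<leftarrow>zs. c z) (u (as @ fmult (\<lambda>_. c z) z # zs))"
    using Cons.IH[of "as @ [fmult (\<lambda>_. c z) z]"] Cons.prems by simp
  also have "u (as @ fmult (\<lambda>_. c z) z # zs) = fmult (\<lambda>_. c z) (u (as @ z # zs))"
    using Cons.prems by (intro tensor_fmult[OF u] smooth_const) auto
  finally show ?case by (simp add: fmult_def mult_ac)
qed

lemma continuous_on_len: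
  assumes "\<xi> \<in> V"
  shows "continuous_on S (\<lambda>p. len p (\<xi> p))"
proof -
  have "(\<lambda>p. g p (\<xi> p) (\<xi> p)) \<in> smooth_functions M"
    using metric assms unfolding riemannian_metric_def by blast
  from smooth_continuous[OF this] show ?thesis
    by (intro continuous_on_real_sqrt) (rule continuous_on_subset, auto)
qed

text \<open>A tuple of fields that is nearly optimal at a point stays admissible nearby after
  normalization, so the pointwise norm is lower semicontinuous.\<close>
lemma open_max_norm_greater:
  assumes u: "u \<in> T q"
  shows "open {p. a < max_norm M g q u p}"
proof (subst open_subopen, intro ballI)
  fix p assume "p \<in> {p. a < max_norm M g q u p}"
  then obtain zs where zs: "length zs = q" "set zs \<subseteq> {\<xi> \<in> V. g p (\<xi> p) (\<xi> p) = 1}"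
    and a: "a < ennreal (len p (u zs p))"
    unfolding max_norm_def by (auto simp: less_SUP_iff)
  have V: "set zs \<subseteq> V" using zs by auto
  \<comment> \<open>\<open>c x z\<close> rescales \<open>z\<close> to unit length at
    \<open>x\<close>, \<open>U\<close> is where this is possible for all of \<open>zs\<close>, and
    \<open>F x\<close> is the length at \<open>x\<close> of the value on the rescaled tuple. At
    \<open>p\<close> all factors are 1.\<close>
  define c where "c x z = 1 / len x (z x)" for x and z :: "'a vfield"
  define F where "F x = (\<Prod>z\<leftarrow>zs. c x z) * len x (u zs x)" for x
  define U where "U = (\<Inter>z\<in>set zs. {x. 0 < len x (z x)})"
  have "open U"
    unfolding U_def using V
    by (intro open_INT finite_set ballI open_Collect_less continuous_on_const continuous_on_len) auto
  have "continuous_on U (\<lambda>x. \<Prod>z\<leftarrow>zs'. c x z)" if "set zs' \<subseteq> set zs" for zs'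
    using that
  proof (induction zs')
    case (Cons z zs')
    then have z: "z \<in> V" "\<forall>x\<in>U. len x (z x) \<noteq> 0"
      using V by (auto simp: U_def) fastforce
    then have "continuous_on U (\<lambda>x. c x z)"
      unfolding c_def by (intro continuous_on_divide continuous_on_const continuous_on_len)
    then show ?case using Cons by (auto intro: continuous_on_mult)
  qed simp
  then have "continuous_on U F"
    unfolding F_def by (intro continuous_on_mult continuous_on_len tensor_closed[OF u]) auto
  then have "continuous_on U (\<lambda>x. ennreal (F x))"
    by (rule continuous_on_ennreal)
  then have "open ((\<lambda>x. ennreal (F x)) -` {a<..} \<inter> U)"
    using \<open>open U\<close> by (simp add: continuous_on_open_vimage)
  moreover have "p \<in> (\<lambda>x. ennreal (F x)) -` {a<..} \<inter> U"
  proof -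
    have "(\<Prod>z\<leftarrow>zs'. c p z) = 1" if "set zs' \<subseteq> set zs" for zs'
      using that zs(2) by (induction zs') (auto simp: c_def)
    then show ?thesis using a zs(2) by (auto simp: F_def U_def)
  qed
  moreover have "(\<lambda>x. ennreal (F x)) -` {a<..} \<inter> U \<subseteq> {p. a < max_norm M g q u p}"
  proof
    fix x assume x: "x \<in> (\<lambda>x. ennreal (F x)) -` {a<..} \<inter> U"
    \<comment> \<open>The factors are frozen at \<open>x\<close>, so the rescaled fields are smooth
      on the whole manifold, even where some field in \<open>zs\<close> vanishes.\<close>
    define zs' where "zs' = map (\<lambda>z. fmult (\<lambda>_. c x z) z) zs"
    have "u zs' = fmult (\<lambda>_. \<Prod>z\<leftarrow>zs. c x z) (u zs)"
      unfolding zs'_def using tensor_map_scale[OF u, of "[]" zs "c x"] V by simp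
    then have "g x (u zs' x) (u zs' x) = (\<Prod>z\<leftarrow>zs. c x z)\<^sup>2 * g x (u zs x) (u zs x)"
      using g_scale2[OF vector_fields_tangent[OF tensor_closed[OF u]]] by (simp add: fmult_def)
    moreover have pos: "0 < len x (z x)" if "z \<in> set zs" for z
      using x that by (auto simp: U_def)
    then have "0 \<le> (\<Prod>z\<leftarrow>zs. c x z)"
      by (intro prod_list_nonneg) (fastforce simp: c_def intro: less_imp_le)
    ultimately have "len x (u zs' x) = F x"
      by (simp add: F_def real_sqrt_mult)
    moreover have "zs' \<in> {zs. length zs = q \<and> set zs \<subseteq> {\<xi> \<in> V. g x (\<xi> x) (\<xi> x) = 1}}"
    proof -
      have "fmult (\<lambda>_. c x z) z \<in> V \<and> g x (fmult (\<lambda>_. c x z) z x) (fmult (\<lambda>_. c x z) z x) = 1"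
        if "z \<in> set zs" for z
      proof
        have z: "z \<in> V" using that V by auto
        then show "fmult (\<lambda>_. c x z) z \<in> V" by (intro vector_fields_fmult smooth_const)
        show "g x (fmult (\<lambda>_. c x z) z x) (fmult (\<lambda>_. c x z) z x) = 1"
        proof -
          have "g x (fmult (\<lambda>_. c x z) z x) (fmult (\<lambda>_. c x z) z x) = (c x z)\<^sup>2 * g x (z x) (z x)"
            unfolding fmult_def by (rule g_scale2[OF vector_fields_tangent[OF z]])
          then show ?thesis using pos[OF that] by (simp add: c_def power_divide)
        qed
      qed
      then show ?thesis using zs(1) by (auto simp: zs'_def)
    qed
    ultimately have "ennreal (F x) \<le> max_norm M g q u x"
      unfolding max_norm_def by (intro SUP_upper2[of zs']) auto
    then show "x \<in> {p. a < max_norm M g q u p}"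
      using x by auto
  qed
  ultimately show "\<exists>S. open S \<and> p \<in> S \<and> S \<subseteq> {p. a < max_norm M g q u p}" by blast
qed

lemma max_norm_measurable:
  assumes "u \<in> T q" and vol: "sets vol = sets borel"
  shows "max_norm M g q u \<in> borel_measurable vol"
proof (rule borel_measurableI_greater)
  show "{x \<in> space vol. a < max_norm M g q u x} \<in> sets vol" for a
    using open_max_norm_greater[OF assms(1), of a] sets_eq_imp_space_eq[OF vol] vol by simp
qed

end

section \<open>Minkowski's inequality for extended nonnegative functions\<close>

lemma square_add_le:
  fixes x y :: ennreal and t :: real
  assumes "t > 0"
  shows "(x + y)\<^sup>2 \<le> ennreal (1 + t) * x\<^sup>2 + ennreal (1 + 1 / t) * y\<^sup>2"
proof (cases x; cases y)
  fix a b assume a: "x = ennreal a" "0 \<le> a" and b: "y = ennreal b" "0 \<le> b"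
  \<comment> \<open>Young's inequality: the mixed term \<open>2 * a * b\<close> is at most
    \<open>t * a\<^sup>2 + b\<^sup>2 / t\<close>.\<close>
  have "0 \<le> (t * a - b)\<^sup>2 / t" using assms by simp
  also have "\<dots> = t * a\<^sup>2 - 2 * a * b + b\<^sup>2 / t"
    using assms by (simp add: field_simps power2_eq_square)
  finally have "(a + b)\<^sup>2 \<le> (1 + t) * a\<^sup>2 + (1 + 1 / t) * b\<^sup>2"
    by (simp add: power2_sum algebra_simps)
  then have "ennreal ((a + b)\<^sup>2) \<le> ennreal ((1 + t) * a\<^sup>2 + (1 + 1 / t) * b\<^sup>2)"
    by (rule ennreal_leI)
  moreover have "(x + y)\<^sup>2 = ennreal ((a + b)\<^sup>2)"
    using a b by (simp add: ennreal_power flip: ennreal_plus)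
  ultimately show ?thesis
    using a b assms by (simp add: ennreal_plus ennreal_mult ennreal_power)
qed (use assms in \<open>auto simp: ennreal_mult_top power2_eq_square\<close>)

text \<open>For finite \<open>F\<close> and \<open>G\<close> the infimum of the right-hand sides
  over \<open>t\<close> is the square of the sum of the two roots. Minkowski's inequality is thereby
  reduced to bounds linear in \<open>F\<close> and \<open>G\<close>, which pass through integrals
  and sums.\<close>

lemma ennreal_sqrt_le_add:
  assumes H: "\<And>t::real. t > 0 \<Longrightarrow> H \<le> ennreal (1 + t) * F + ennreal (1 + 1 / t) * G"
  shows "ennreal_sqrt H \<le> ennreal_sqrt F + ennreal_sqrt G"
proof (cases "F = top \<or> G = top")
  case False
  then obtain a b where a: "F = ennreal a" "0 \<le> a" and b: "G = ennreal b" "0 \<le> b"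
    by (metis ennreal_cases)
  have le: "H \<le> ennreal ((1 + t) * a + (1 + 1 / t) * b)" if "t > 0" for t
    using H[OF that] that a b by (simp add: ennreal_plus ennreal_mult)
  then obtain c where c: "H = ennreal c" "0 \<le> c"
    using le[of 1] by (cases H) (auto simp: top_unique)
  have le: "c \<le> (1 + t) * a + (1 + 1 / t) * b" if "t > 0" for t
  proof -
    have "0 \<le> (1 + t) * a + (1 + 1 / t) * b"
      using a b that by (intro add_nonneg_nonneg mult_nonneg_nonneg) auto
    then show ?thesis using le[OF that] c by simp
  qed
  have "c \<le> (sqrt a + sqrt b)\<^sup>2"
  proof (cases "a = 0 \<or> b = 0")
    case True
    \<comment> \<open>The infimum need not be attained here: it is approached for large
      \<open>t\<close> if \<open>a = 0\<close> and for small \<open>t\<close> if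
      \<open>b = 0\<close>. The added 1 in the witnesses keeps them positive and defined.\<close>
    have "c \<le> a + b + e" if e: "e > 0" for e
    proof (cases "a = 0")
      case True
      have "b / ((b + 1) / e) \<le> e" using e b by (simp add: field_simps)
      then show ?thesis
        using le[of "(b + 1) / e"] True e b by (simp add: algebra_simps)
    next
      case False
      have "e / (a + 1) * a \<le> e" using e a by (simp add: field_simps)
      then show ?thesis
        using le[of "e / (a + 1)"] False True e a \<open>a = 0 \<or> b = 0\<close> by (simp add: distrib_right)
    qed
    then have "c \<le> a + b" by (rule field_le_epsilon)
    then show ?thesis using True a b by auto
  next
    case False
    then have pos: "sqrt a > 0" "sqrt b > 0" using a b by auto
    define x y where "x = sqrt a" and "y = sqrt b"
    have xy: "a = x\<^sup>2" "b = y\<^sup>2" "x > 0" "y > 0" using a b pos by (auto simp: x_def y_def)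
    \<comment> \<open>\<open>t = y / x\<close> minimizes the bound.\<close>
    have "c \<le> (1 + y / x) * x\<^sup>2 + (1 + 1 / (y / x)) * y\<^sup>2"
      using le[of "y / x"] xy by simp
    also have "\<dots> = (x + y)\<^sup>2" using xy(3,4) by (simp add: field_simps power2_eq_square)
    finally show ?thesis by (simp add: x_def y_def)
  qed
  then have "sqrt c \<le> sqrt a + sqrt b"
    using a b by (intro real_le_lsqrt) (auto simp: c)
  then show ?thesis
    using a b c by (simp add: ennreal_sqrt_def ennreal_leI flip: ennreal_plus)
qed (auto simp: ennreal_sqrt_def)

text \<open>One parameter \<open>t\<close> is shared by all points and all \<open>s\<close>, so the
  orders of differentiation and the integral are treated at once and \<open>t\<close> is optimized
  only at the end. Measurability of \<open>f s\<close> and \<open>g s\<close> splits the integral of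
  the sum.\<close>

lemma ennreal_sqrt_Minkowski:
  fixes f g h :: "'i \<Rightarrow> 'b \<Rightarrow> ennreal"
  assumes meas: "\<And>s. s \<in> I \<Longrightarrow> f s \<in> borel_measurable \<mu>" "\<And>s. s \<in> I \<Longrightarrow> g s \<in> borel_measurable \<mu>"
    and le: "\<And>s p. s \<in> I \<Longrightarrow> h s p \<le> f s p + g s p"
  shows "ennreal_sqrt (\<Sum>s\<in>I. \<integral>\<^sup>+p. (h s p)\<^sup>2 \<partial>\<mu>)
    \<le> ennreal_sqrt (\<Sum>s\<in>I. \<integral>\<^sup>+p. (f s p)\<^sup>2 \<partial>\<mu>) + ennreal_sqrt (\<Sum>s\<in>I. \<integral>\<^sup>+p. (g s p)\<^sup>2 \<partial>\<mu>)"
proof (rule ennreal_sqrt_le_add)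
  fix t :: real assume t: "t > 0"
  have "(\<integral>\<^sup>+p. (h s p)\<^sup>2 \<partial>\<mu>)
      \<le> ennreal (1 + t) * (\<integral>\<^sup>+p. (f s p)\<^sup>2 \<partial>\<mu>) + ennreal (1 + 1 / t) * (\<integral>\<^sup>+p. (g s p)\<^sup>2 \<partial>\<mu>)"
    if s: "s \<in> I" for s
  proof -
    have "(\<integral>\<^sup>+p. (h s p)\<^sup>2 \<partial>\<mu>)
        \<le> (\<integral>\<^sup>+p. ennreal (1 + t) * (f s p)\<^sup>2 + ennreal (1 + 1 / t) * (g s p)\<^sup>2 \<partial>\<mu>)"
    proof (rule nn_integral_mono)
      fix p
      have "(h s p)\<^sup>2 \<le> (f s p + g s p)\<^sup>2" using le[OF s] by (intro power_mono) auto
      also have "\<dots> \<le> ennreal (1 + t) * (f s p)\<^sup>2 + ennreal (1 + 1 / t) * (g s p)\<^sup>2"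
        by (rule square_add_le[OF t])
      finally show "(h s p)\<^sup>2 \<le> ennreal (1 + t) * (f s p)\<^sup>2 + ennreal (1 + 1 / t) * (g s p)\<^sup>2" .
    qed
    also have "\<dots> = ennreal (1 + t) * (\<integral>\<^sup>+p. (f s p)\<^sup>2 \<partial>\<mu>) + ennreal (1 + 1 / t) * (\<integral>\<^sup>+p. (g s p)\<^sup>2 \<partial>\<mu>)"
      using meas[OF s] by (simp add: nn_integral_add nn_integral_cmult)
    finally show ?thesis .
  qed
  then have "(\<Sum>s\<in>I. \<integral>\<^sup>+p. (h s p)\<^sup>2 \<partial>\<mu>) \<le> (\<Sum>s\<in>I. ennreal (1 + t) * (\<integral>\<^sup>+p. (f s p)\<^sup>2 \<partial>\<mu>)
      + ennreal (1 + 1 / t) * (\<integral>\<^sup>+p. (g s p)\<^sup>2 \<partial>\<mu>))"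
    by (rule sum_mono)
  then show "(\<Sum>s\<in>I. \<integral>\<^sup>+p. (h s p)\<^sup>2 \<partial>\<mu>) \<le> ennreal (1 + t) * (\<Sum>s\<in>I. \<integral>\<^sup>+p. (f s p)\<^sup>2 \<partial>\<mu>)
      + ennreal (1 + 1 / t) * (\<Sum>s\<in>I. \<integral>\<^sup>+p. (g s p)\<^sup>2 \<partial>\<mu>)"
    by (simp add: sum.distrib sum_distrib_left)
qed

context riemannian_manifold
begin

lemma sobolev_norm_add:
  assumes conn: "connection M nab" and vol: "sets vol = sets borel"
    and u: "u \<in> T q" and v: "v \<in> T q"
  shows "sobolev_norm M nab g vol r q (u + v) \<le> sobolev_norm M nab g vol r q u + sobolev_norm M nab g vol r q v"
proof -
  interpret manifold_connection M nab by unfold_locales (rule conn)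
  show ?thesis
    unfolding sobolev_norm_def nabla_pow_eq[OF u] nabla_pow_eq[OF v]
      nabla_pow_eq[OF tensor_plus_closed[OF u v]] D_pow_add[OF u v]
    by (intro ennreal_sqrt_Minkowski max_norm_measurable[OF _ vol] max_norm_add D_pow_closed u v)
qed

lemma sobolev_norm_uminus:
  assumes conn: "connection M nab" and u: "u \<in> T q"
  shows "sobolev_norm M nab g vol r q (- u) = sobolev_norm M nab g vol r q u"
proof -
  interpret manifold_connection M nab by unfold_locales (rule conn)
  show ?thesis
    unfolding sobolev_norm_def nabla_pow_eq[OF u] nabla_pow_eq[OF tensor_uminus_closed[OF u]]
      D_pow_uminus[OF u] max_norm_uminus[OF D_pow_closed[OF u]] by (rule refl)
qed

end


section \<open>The estimate\<close>

text \<open>The disjunction covers the Sobolev norm and any other algebra norm. \<open>nab'\<close>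
  is the connection from which the Sobolev norm is built, for instance that of the metric, while
  \<open>nab\<close> is the torsion free connection that differentiates. The second conjunct is the
  closed form of the constants.\<close>

theorem mainTheorem1:
  fixes M :: "('a::{t2_space, second_countable_topology}, 'n::finite) atlas"
    and nab nab' :: "'a vfield \<Rightarrow> 'a vfield \<Rightarrow> 'a vfield"
    and g :: "'a metric" and vol :: "'a measure"
    and A :: "'a tensor" and \<xi> :: "nat \<Rightarrow> 'a vfield"
    and N :: "nat \<Rightarrow> 'a tensor \<Rightarrow> ennreal" and C :: real
    and k h r :: nat
  assumes "smooth_manifold M"
    and "connection M nab" and "torsion_free M nab"
    and "riemannian_metric M g" and "riemannian_volume M g vol" and "connection M nab'"
    and "N = sobolev_norm M nab' g vol r \<or> tensor_norm M N"
    and "algebra_constant M N C"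
    and "A \<in> tensor_fields M 1"
    and "k \<ge> 1"
    and "\<And>j. j \<in> {1..k} \<Longrightarrow> \<xi> j \<in> vector_fields M"
  shows "ennreal (1 / fact h) *
           N (h + 1) (nabla_pow M nab h (foldr (\<lambda>j. lie_derivative M (\<xi> j)) [1..<k + 1] A))
         \<le> ennreal (C ^ k) *
           (\<Sum>(P, H) \<in> Dyck k \<times> compositions (k + 1) h.
              of_nat (Dyck_C k P) *
              (ennreal (1 / fact (H (k + 1))) *
               N (H (k + 1) + nat (Dyck_D P k) + 1)
                 (nabla_pow M nab (H (k + 1) + nat (Dyck_D P k)) A)) *
              (\<Prod>j = 1..k. ennreal (1 / fact (H j)) *
                 N (H j + P j) (nabla_pow M nab (H j + P j) (vector_tensor (\<xi> j)))))
       \<and> (\<forall>P\<in>Dyck k. real (Dyck_C k P) =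
            (\<Prod>j \<in> {j \<in> {1..k}. P j \<noteq> 0}.
               (2 + of_int (Dyck_D P j) / real (P j))
               * real (binom (Dyck_D P (j - 1)) (int (P j) - 1))))"
proof -
  interpret riemannian_manifold M g by unfold_locales (fact assms)+
  have vol: "sets vol = sets borel"
    using assms(5) by (simp add: riemannian_volume_def)
  have N: "N q (u + v) \<le> N q u + N q v \<and> N q (- u) = N q u" if "u \<in> T q" "v \<in> T q" for q u v
    using assms(7)
  proof
    assume "N = sobolev_norm M nab' g vol r"
    then show ?thesis
      using sobolev_norm_add[OF assms(6) vol that] sobolev_norm_uminus[OF assms(6) that(1)] by simp
  next
    assume N: "tensor_norm M N"
    have "(\<lambda>zs. fmult (\<lambda>_. - 1) (u zs)) = - u"
      by (simp add: fmult_minus_one fun_Compl_def)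
    moreover have "N q (\<lambda>zs. fmult (\<lambda>_. - 1) (u zs)) = ennreal \<bar>- 1\<bar> * N q u"
      using N that(1) unfolding tensor_norm_def by blast
    moreover have "N q (u + v) \<le> N q u + N q v"
      using N that unfolding tensor_norm_def by blast
    ultimately show ?thesis by simp
  qed
  interpret algebra_norm M nab N C
    by unfold_locales (use assms N in blast)+
  have v: "nabla_pow M nab s (vector_tensor (\<xi> j)) = (D ^^ s) (vector_tensor (\<xi> j))" if "j \<in> {1..k}" for s j
    by (intro nabla_pow_eq[of _ 0] vector_tensor_closed assms(11) that)
  have L: "foldr (\<lambda>j. lie_derivative M (\<xi> j)) [1..<k + 1] A \<in> T 1"
    by (rule foldr_lie_derivative_closed[OF tf assms(9)]) (use assms(11) in auto)
  have "(\<Prod>j = 1..k. ennreal (1 / fact (H j)) *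
        N (H j + P j) (nabla_pow M nab (H j + P j) (vector_tensor (\<xi> j))))
      = (\<Prod>j = 1..k. ennreal (1 / fact (H j)) * N (H j + P j) ((D ^^ (H j + P j)) (vector_tensor (\<xi> j))))"
    for H P
    by (intro prod.cong refl) (simp add: v)
  then show ?thesis
    unfolding nabla_pow_eq[OF L] nabla_pow_eq[OF assms(9)]
    using N_iterated_lie_derivative[OF assms(9,11)] Dyck_C_eq by simp
qed

end
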